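(* Let $p$ be a prime and let $\Gamma$ be a strictly Deza circulant with parameters $(2p,k,b,a)$. Then $p\equiv 1 \pmod 4$, and $\Gamma$ is isomorphic to the $2$-clique-extension $P(p)[K_2]$ of the Paley graph $P(p)$. In particular, $k=p$, $b=p-1$ and $a=\frac{p-1}{2}$.
   Context: Graphs are finite, undirected and simple. A graph is strongly regular with parameters $(n,k,\lambda,\mu)$ if it has $n$ vertices, is $k$-regular, any two adjacent vertices have exactly $\lambda$ common neighbours, and any two distinct non-adjacent vertices have exactly $\mu$ common neighbours. Let $n,k,b,a$ be integers with $0\le a\le b\le k<n$. A graph is a Deza graph with parameters $(n,k,b,a)$ if it has $n$ vertices, is $k$-regular, and for any two distinct vertices the number of their common neighbours takes precisely the values $a$ or $b$ (there is a pair of distinct vertices with $a$ common neighbours and a pair with $b$ common neighbours). A strictly Deza graph is a Deza graph that has diameter $2$ and is not strongly regular. For a group $G$ and a generating set $S$ of $G$ with $e_G\notin S$ and $S^{-1}=S$, the Cayley graph $Cay(G,S)$ has vertex set $G$, with $x,y$ adjacent if and only if $xy^{-1}\in S$. A circulant is a graph isomorphic to a Cayley graph of a cyclic group. For a prime power $q\equiv 1\pmod 4$, the Paley graph $P(q)$ is the Cayley graph of the additive group $\mathbb{F}_q^+$ whose connection set is the set of squares of $\mathbb{F}_q^*$. The $2$-clique-extension $\Gamma_1[K_2]$ of a graph $\Gamma_1$ is the lexicographical product of $\Gamma_1$ with $K_2$: its vertex set is $V(\Gamma_1)\times V(K_2)$, and $(u_1,u_2)$, $(v_1,v_2)$ are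 adjacent if and only if either $u_1\sim v_1$ in $\Gamma_1$, or $u_1=v_1$ and $u_2\sim v_2$ in $K_2$. *)

theory Defs
  imports
    "Graph_Theory.Graph_Theory"
    "HOL-Algebra.Elementary_Groups"
    "HOL-Number_Theory.Residues"
begin

text \<open>
  A finite simple undirected graph is a \<^locale>\<open>pair_graph\<close>: a finite vertex set with a symmetric
  and irreflexive arc relation, each edge being represented by its two opposite arcs.
  Isomorphism is \<^const>\<open>digraph_iso\<close>; for such graphs it is the usual notion:
\<close>

lemma digraph_iso_with_proj_iff:
  assumes "pair_wf_digraph G" and "pair_wf_digraph H"
  shows "digraph_iso (with_proj G) (with_proj H) \<longleftrightarrow>
    (\<exists>f. bij_betw f (pverts G) (pverts H) \<and>
      (\<forall>u\<in>pverts G. \<forall>v\<in>pverts G. (u, v) \<in> parcs G \<longleftrightarrow> (f u, f v) \<in> parcs H))"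
    (is "?L \<longleftrightarrow> ?R")
proof
  interpret G: pair_wf_digraph G by fact
  assume ?L
  then obtain h where h: "pre_digraph.digraph_isomorphism (with_proj G) h"
    and H: "with_proj H = app_iso h (with_proj G)"
    unfolding digraph_iso_def by blast
  let ?f = "iso_verts h"
  have inj: "inj_on ?f (pverts G)"
    using h by (simp add: pre_digraph.digraph_isomorphism_def)
  have verts: "pverts H = ?f ` pverts G"
    using arg_cong[OF H, of verts] by simp
  have arcs: "parcs H = (\<lambda>(u, v). (?f u, ?f v)) ` parcs G"
    using arg_cong[OF H, of arcs_ends] G.arcs_ends_app_iso_eq[OF h] by simp
  have "(u, v) \<in> parcs G \<longleftrightarrow> (?f u, ?f v) \<in> parcs H" if "u \<in> pverts G" "v \<in> pverts G" for u v
  proof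
    assume "(?f u, ?f v) \<in> parcs H"
    then obtain u' v' where e: "(u', v') \<in> parcs G" and eq: "?f u = ?f u'" "?f v = ?f v'"
      unfolding arcs by auto
    from e have "u' \<in> pverts G" "v' \<in> pverts G" by (blast dest: G.wellformed')+
    with that eq inj have "u = u'" "v = v'" by (blast dest: inj_onD)+
    with e show "(u, v) \<in> parcs G" by simp
  qed (auto simp: arcs)
  with inj verts show ?R by (intro exI[of _ ?f]) (simp add: bij_betw_def)
next
  interpret G: pair_wf_digraph G by fact
  interpret H: pair_wf_digraph H by fact
  assume ?R
  then obtain f where bij: "bij_betw f (pverts G) (pverts H)"
    and adj: "\<And>u v. u \<in> pverts G \<Longrightarrow> v \<in> pverts G \<Longrightarrow> (u, v) \<in> parcs G \<longleftrightarrow> (f u, f v) \<in> parcs H"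
    by blast
  let ?h = "\<lparr>iso_verts = f, iso_arcs = map_prod f f, iso_head = snd, iso_tail = fst\<rparr>"
  have inj: "inj_on f (pverts G)" and img: "f ` pverts G = pverts H"
    using bij by (auto simp: bij_betw_def)
  have injA: "inj_on (map_prod f f) (parcs G)"
    by (rule inj_on_subset[OF map_prod_inj_on[OF inj inj]]) (use G.wellformed' in auto)
  have "parcs H = map_prod f f ` parcs G"
  proof (intro equalityI subsetI)
    fix e assume e: "e \<in> parcs H"
    obtain x y where xy: "e = (x, y)" by fastforce
    with e have "x \<in> f ` pverts G" "y \<in> f ` pverts G"
      unfolding img by (blast dest: H.wellformed')+
    then obtain u v where "u \<in> pverts G" "v \<in> pverts G" "x = f u" "y = f v" by blast
    with e xy adj have "(u, v) \<in> parcs G" "e = map_prod f f (u, v)" by simp_all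
    then show "e \<in> map_prod f f ` parcs G" by (rule rev_image_eqI)
  next
    fix e assume "e \<in> map_prod f f ` parcs G"
    then obtain u v where uv: "(u, v) \<in> parcs G" "e = (f u, f v)" by auto
    then have "u \<in> pverts G" "v \<in> pverts G" by (blast dest: G.wellformed')+
    with uv adj show "e \<in> parcs H" by simp
  qed
  then have "with_proj H = app_iso ?h (with_proj G)"
    using img by (simp add: app_iso_def with_proj_def)
  moreover have "pre_digraph.digraph_isomorphism (with_proj G) ?h"
    using inj injA G.wf_digraph_axioms by (simp add: pre_digraph.digraph_isomorphism_def)
  ultimately show ?L unfolding digraph_iso_def by blast
qed

definition common_neighbours :: "'a pair_pre_digraph \<Rightarrow> 'a \<Rightarrow> 'a \<Rightarrow> 'a set" where
  "common_neighbours \<Gamma> u v = {w \<in> pverts \<Gamma>. (u, w) \<in> parcs \<Gamma> \<and> (v, w) \<in> parcs \<Gamma>}"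

definition regular_graph :: "'a pair_pre_digraph \<Rightarrow> nat \<Rightarrow> nat \<Rightarrow> bool" where
  "regular_graph \<Gamma> n k \<longleftrightarrow>
     pair_graph \<Gamma> \<and> card (pverts \<Gamma>) = n \<and> (\<forall>u\<in>pverts \<Gamma>. out_degree (with_proj \<Gamma>) u = k)"

definition strongly_regular :: "'a pair_pre_digraph \<Rightarrow> nat \<Rightarrow> nat \<Rightarrow> nat \<Rightarrow> nat \<Rightarrow> bool" where
  "strongly_regular \<Gamma> n k l m \<longleftrightarrow>
     regular_graph \<Gamma> n k \<and>
     (\<forall>u\<in>pverts \<Gamma>. \<forall>v\<in>pverts \<Gamma>. (u, v) \<in> parcs \<Gamma> \<longrightarrow> card (common_neighbours \<Gamma> u v) = l) \<and>
     (\<forall>u\<in>pverts \<Gamma>. \<forall>v\<in>pverts \<Gamma>. u \<noteq> v \<and> (u, v) \<notin> parcs \<Gamma> \<longrightarrow>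
        card (common_neighbours \<Gamma> u v) = m)"

definition deza_graph :: "'a pair_pre_digraph \<Rightarrow> nat \<Rightarrow> nat \<Rightarrow> nat \<Rightarrow> nat \<Rightarrow> bool" where
  "deza_graph \<Gamma> n k b a \<longleftrightarrow>
     a \<le> b \<and> b \<le> k \<and> k < n \<and> regular_graph \<Gamma> n k \<and>
     {card (common_neighbours \<Gamma> u v) | u v. u \<in> pverts \<Gamma> \<and> v \<in> pverts \<Gamma> \<and> u \<noteq> v} = {a, b}"

text \<open>
  With all arcs of cost 1, the function \<open>wf_digraph.\<mu>\<close> is the graph distance, which is infinite
  between distinct components.
\<close>

definition diameter :: "'a pair_pre_digraph \<Rightarrow> ereal" where
  "diameter \<Gamma> =
     (SUP u\<in>pverts \<Gamma>. SUP v\<in>pverts \<Gamma>. wf_digraph.\<mu> (with_proj \<Gamma>) (\<lambda>_. 1) u v)"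

definition strictly_deza :: "'a pair_pre_digraph \<Rightarrow> nat \<Rightarrow> nat \<Rightarrow> nat \<Rightarrow> nat \<Rightarrow> bool" where
  "strictly_deza \<Gamma> n k b a \<longleftrightarrow>
     deza_graph \<Gamma> n k b a \<and> diameter \<Gamma> = 2 \<and> \<not> (\<exists>n' k' l m. strongly_regular \<Gamma> n' k' l m)"

definition connection_set :: "('g, 'm) monoid_scheme \<Rightarrow> 'g set \<Rightarrow> bool" where
  "connection_set G S \<longleftrightarrow>
     S \<subseteq> carrier G \<and> \<one>\<^bsub>G\<^esub> \<notin> S \<and> set_inv\<^bsub>G\<^esub> S = S \<and> generate G S = carrier G"

definition cayley_graph :: "('g, 'm) monoid_scheme \<Rightarrow> 'g set \<Rightarrow> 'g pair_pre_digraph" where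
  "cayley_graph G S =
     \<lparr>pverts = carrier G,
      parcs = {(x, y). x \<in> carrier G \<and> y \<in> carrier G \<and> x \<otimes>\<^bsub>G\<^esub> inv\<^bsub>G\<^esub> y \<in> S}\<rparr>"

text \<open>
  HOL cannot quantify existentially over the type of the group elements, so this type is a
  parameter; a theorem assuming \<open>circulant TYPE('g) \<Gamma>\<close> for a type variable \<open>'g\<close> covers cyclic
  groups over every type.
\<close>

definition circulant :: "'g itself \<Rightarrow> 'a pair_pre_digraph \<Rightarrow> bool" where
  "circulant _ \<Gamma> \<longleftrightarrow>
     (\<exists>(G :: 'g monoid) S. group G \<and> cyclic_group G \<and> connection_set G S \<and>
        digraph_iso (with_proj \<Gamma>) (with_proj (cayley_graph G S)))"

text \<open>
  The Paley graph is intended for a finite field \<open>R\<close> of order congruent to 1 modulo 4 (so that -1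
  is a square); \<^term>\<open>Units R\<close> is then the multiplicative group of \<open>R\<close>.
\<close>

definition paley_graph :: "('r, 'm) ring_scheme \<Rightarrow> 'r pair_pre_digraph" where
  "paley_graph R = cayley_graph (add_monoid R) ((\<lambda>x. x \<otimes>\<^bsub>R\<^esub> x) ` Units R)"

definition complete_graph :: "'a set \<Rightarrow> 'a pair_pre_digraph" where
  "complete_graph V = \<lparr>pverts = V, parcs = {(u, v). u \<in> V \<and> v \<in> V \<and> u \<noteq> v}\<rparr>"

definition lexicographic_product ::
    "'a pair_pre_digraph \<Rightarrow> 'b pair_pre_digraph \<Rightarrow> ('a \<times> 'b) pair_pre_digraph" where
  "lexicographic_product \<Gamma>\<^sub>1 \<Gamma>\<^sub>2 =
     \<lparr>pverts = pverts \<Gamma>\<^sub>1 \<times> pverts \<Gamma>\<^sub>2,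
      parcs = {((u\<^sub>1, u\<^sub>2), (v\<^sub>1, v\<^sub>2)).
        u\<^sub>1 \<in> pverts \<Gamma>\<^sub>1 \<and> u\<^sub>2 \<in> pverts \<Gamma>\<^sub>2 \<and> v\<^sub>1 \<in> pverts \<Gamma>\<^sub>1 \<and> v\<^sub>2 \<in> pverts \<Gamma>\<^sub>2 \<and>
        ((u\<^sub>1, v\<^sub>1) \<in> parcs \<Gamma>\<^sub>1 \<or> u\<^sub>1 = v\<^sub>1 \<and> (u\<^sub>2, v\<^sub>2) \<in> parcs \<Gamma>\<^sub>2)}\<rparr>"

definition two_clique_extension :: "'a pair_pre_digraph \<Rightarrow> ('a \<times> nat) pair_pre_digraph" where
  "two_clique_extension \<Gamma> = lexicographic_product \<Gamma> (complete_graph {0, 1})"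

end

theory Submission
  imports Defs "HOL-Computational_Algebra.Polynomial"
begin

text \<open>
  For odd \<open>p\<close>, write the connection set in the group ring of \<open>\<int>/2p = \<int>/p \<times> \<langle>z\<rangle>\<close> as \<open>A + zB\<close>, so
  that common neighbours are counted by \<open>A\<^sup>2 + B\<^sup>2\<close> and \<open>2AB\<close>.

  If \<open>AB\<close> is constant then \<open>p\<close> divides \<open>|A| |B|\<close>, and diameter 2 forces \<open>B = \<int>/p\<close>; the convolution
  square of the complement of \<open>A\<close> then takes, off 0, only the value 0 and one other value, so by
  parity this complement is trivial and the graph is strongly regular. Otherwise both Deza parameters are
  values of \<open>2AB\<close>, hence even. The coefficient of \<open>A\<^sup>2 + B\<^sup>2\<close> at \<open>2h\<close> has the parity of \<open>[h \<in> A] + [h \<in> B]\<close>,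
  so \<open>A\<close> and \<open>B\<close> agree off 0. The case \<open>B = A\<close> leads to a complete multipartite graph by the same
  parity argument. So \<open>B = A \<union> {0}\<close>, and \<open>A\<^sup>2 + A\<close> is constant off 0. Then every power of \<open>A\<close> is a
  combination of \<open>A\<close>, 1 and \<open>\<int>/p\<close>; since \<open>A\<^sup>q\<close> is congruent to \<open>{qi | i \<in> A}\<close> modulo each prime \<open>q \<noteq> p\<close>,
  multiplication by \<open>q\<close> fixes \<open>A\<close> or exchanges it with its complement off 0. Squares therefore
  fix \<open>A\<close>, which is thus the set of quadratic residues or of non-residues. Counting \<open>A\<^sup>2 + A\<close> gives
  \<open>p = 4c + 1\<close>, without using that \<open>-1\<close> is a square.
\<close>

section \<open>Cyclic convolution\<close>

lemma bij_betw_affine_mod: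
  fixes t n c :: int
  assumes "n > 0" "coprime t n"
  shows "bij_betw (\<lambda>i. (t * i + c) mod n) {0..<n} {0..<n}"
proof -
  have "inj_on (\<lambda>i. (t * i + c) mod n) {0..<n}"
  proof (rule inj_onI)
    fix x y assume xy: "x \<in> {0..<n}" "y \<in> {0..<n}" "(t * x + c) mod n = (t * y + c) mod n"
    then have "[t * x = t * y] (mod n)"
      by (simp add: cong_def [symmetric] cong_add_rcancel)
    then have "[x = y] (mod n)"
      using assms(2) by (simp add: cong_mult_lcancel)
    with xy show "x = y" by (simp add: cong_def)
  qed
  moreover have "(\<lambda>i. (t * i + c) mod n) ` {0..<n} \<subseteq> {0..<n}"
    using assms(1) by auto
  ultimately show ?thesis
    using endo_inj_surj[OF finite_atLeastLessThan_int] by (simp add: bij_betw_def)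
qed

text \<open>The substitution rule behind every later change of variable: translations, the
  reflection \<open>i\<close> to \<open>g - i\<close>, and multiplication by a unit.\<close>

lemma sum_periodic_affine:
  fixes t n c :: int and f :: "int \<Rightarrow> 'a::comm_monoid_add"
  assumes "n > 0" "coprime t n" and per: "\<And>i. f (i mod n) = f i"
  shows "(\<Sum>i\<in>{0..<n}. f (t * i + c)) = (\<Sum>i\<in>{0..<n}. f i)"
  using sum.reindex_bij_betw[OF bij_betw_affine_mod[OF assms(1,2)], of f c] by (simp add: per)

text \<open>The product of the group ring of Z/n. Its elements are kept as n-periodic functions on
  all integers, so that arguments like \<open>g - i\<close> need no reduction.\<close>

definition conv :: "int \<Rightarrow> (int \<Rightarrow> int) \<Rightarrow> (int \<Rightarrow> int) \<Rightarrow> int \<Rightarrow> int" where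
  "conv n f h g = (\<Sum>i\<in>{0..<n}. f i * h (g - i))"

lemma periodic_mod_cong:
  fixes n :: int
  assumes per: "\<And>i. f (i mod n) = f i" and "[i = j] (mod n)"
  shows "f i = f j"
  using assms by (metis cong_def)

lemma conv_commute:
  assumes "n > 0" and "\<And>i. f (i mod n) = f i" "\<And>i. h (i mod n) = h i"
  shows "conv n f h g = conv n h f g"
proof -
  have "f ((i mod n)) * h (g - i mod n) = f i * h (g - i)" for i
    using assms periodic_mod_cong[of h n "g - i mod n" "g - i"]
    by (simp add: cong_def mod_simps)
  from sum_periodic_affine[of n "-1" "\<lambda>i. f i * h (g - i)" g, OF assms(1) _ this]
  show ?thesis by (simp add: conv_def mult.commute algebra_simps)
qed

lemma conv_periodic:
  assumes "\<And>i. h (i mod n) = h i"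
  shows "conv n f h (g mod n) = conv n f h g"
proof -
  have "h (g mod n - i) = h (g - i)" for i
    using periodic_mod_cong[of h n "g mod n - i" "g - i"] assms by (simp add: cong_def mod_simps)
  then show ?thesis by (simp add: conv_def)
qed

text \<open>The augmentation of the group ring is multiplicative. This turns convolution identities
  into equations between cardinalities.\<close>

lemma sum_conv:
  assumes "n > 0" and "\<And>i. h (i mod n) = h i"
  shows "(\<Sum>g\<in>{0..<n}. conv n f h g) = (\<Sum>i\<in>{0..<n}. f i) * (\<Sum>i\<in>{0..<n}. h i)"
proof -
  have "(\<Sum>g\<in>{0..<n}. conv n f h g) = (\<Sum>i\<in>{0..<n}. f i * (\<Sum>g\<in>{0..<n}. h (g - i)))"
    unfolding conv_def by (subst sum.swap) (simp add: sum_distrib_left)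
  moreover have "(\<Sum>g\<in>{0..<n}. h (g - i)) = (\<Sum>g\<in>{0..<n}. h g)" for i
    using sum_periodic_affine[of n 1 h "-i"] assms by simp
  ultimately show ?thesis by (simp add: sum_distrib_right)
qed

lemma conv_delta:
  assumes "n > 0" and per: "\<And>i. f (i mod n) = f i"
  shows "conv n f (\<lambda>i. of_bool (n dvd i)) g = f g"
proof -
  have "(\<Sum>i\<in>{0..<n}. f i * of_bool (n dvd (g - i))) = (\<Sum>i\<in>{g mod n}. f i)"
  proof (rule sum.mono_neutral_cong_right)
    show "\<forall>i\<in>{0..<n} - {g mod n}. f i * of_bool (n dvd (g - i)) = 0"
      by (auto simp: mod_eq_dvd_iff [symmetric])
  qed (use assms(1) in \<open>auto simp: mod_eq_dvd_iff [symmetric]\<close>)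
  then show ?thesis by (simp add: conv_def per)
qed

text \<open>The involution \<open>i \<mapsto> 2h - i\<close> has the single fixed point \<open>h\<close> modulo an odd number.\<close>
lemma conv_self_parity:
  assumes "n > 0" "odd n" and per: "\<And>i. a (i mod n) = a i"
  shows "even (conv n (\<lambda>i. of_bool (a i)) (\<lambda>i. of_bool (a i)) (2 * h) - of_bool (a h))"
proof -
  define G :: "int \<Rightarrow> int" where "G j = of_bool (a (h + j)) * of_bool (a (h - j))" for j
  have perG: "of_bool (a (i mod n)) * of_bool (a (2 * h - i mod n)) =
      (of_bool (a i) * of_bool (a (2 * h - i)) :: int)" for i
    using per periodic_mod_cong[of a n "2 * h - i mod n" "2 * h - i"]
    by (simp add: cong_def mod_simps)
  have "conv n (\<lambda>i. of_bool (a i)) (\<lambda>i. of_bool (a i)) (2 * h) = (\<Sum>j\<in>{0..<n}. G j)"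
    using sum_periodic_affine[of n 1 "\<lambda>i. of_bool (a i) * of_bool (a (2 * h - i))" h, OF assms(1) _ perG]
    by (simp add: conv_def G_def algebra_simps)
  also obtain m where n: "n = 2 * m + 1" using assms(2) by (elim oddE)
  then have m: "m \<ge> 0" using assms(1) by simp
  have split: "{0..<n} = insert 0 ({1..m} \<union> {m + 1..<n})" using n m by auto
  have "sum G ({1..m} \<union> {m + 1..<n}) = sum G {1..m} + sum G {m + 1..<n}"
    by (rule sum.union_disjoint) auto
  then have "(\<Sum>j\<in>{0..<n}. G j) = G 0 + ((\<Sum>j\<in>{1..m}. G j) + (\<Sum>j\<in>{m + 1..<n}. G j))"
    unfolding split using m by (subst sum.insert) auto
  also have "(\<Sum>j\<in>{m + 1..<n}. G j) = (\<Sum>j\<in>{1..m}. G j)"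
  proof (rule sum.reindex_bij_witness[of _ "\<lambda>j. n - j" "\<lambda>j. n - j"])
    fix j
    have "a (h + (n - j)) = a (h - j)" "a (h - (n - j)) = a (h + j)"
      by (rule periodic_mod_cong[of a n, OF per]; simp add: cong_iff_dvd_diff)+
    then show "G (n - j) = G j" by (simp add: G_def)
  qed (auto simp: n)
  also have "G 0 = of_bool (a h)" by (simp add: G_def)
  finally show ?thesis by simp
qed

section \<open>Splitting Z/2n for odd n\<close>

text \<open>The isomorphism \<open>\<int>/n \<times> \<int>/2 \<cong> \<int>/2n\<close> for odd \<open>n\<close>, twisted by a unit \<open>t\<close> of \<open>\<int>/n\<close>.\<close>
lemma bij_betw_crt_two:
  fixes n t :: int
  assumes "n > 0" "odd n" "coprime t n"
  shows "bij_betw (\<lambda>(i, d::nat). ((n + 1) * (t * i) + n * int d) mod (2 * n))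
           ({0..<n} \<times> {0, 1}) {0..<2 * n}"
proof -
  \<comment> \<open>Modulo \<open>2 * n\<close>, \<open>n + 1\<close> and \<open>n\<close> are the
    complementary idempotents belonging to the factors Z/n and Z/2: the first is even and congruent
    to 1 modulo \<open>n\<close>, the second is odd.\<close>
  let ?F = "\<lambda>(i, d::nat). ((n + 1) * (t * i) + n * int d) mod (2 * n)"
  have inj: "inj_on ?F ({0..<n} \<times> {0, 1})"
  proof (rule inj_onI, clarsimp)
    fix i j :: int and d e :: nat
    assume ij: "0 \<le> i" "i < n" "0 \<le> j" "j < n" and de: "d = 0 \<or> d = Suc 0" "e = 0 \<or> e = Suc 0"
      and eq: "((n + 1) * (t * i) + n * int d) mod (2 * n) = ((n + 1) * (t * j) + n * int e) mod (2 * n)"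
    then have c: "[(n + 1) * (t * i) + n * int d = (n + 1) * (t * j) + n * int e] (mod (2 * n))"
      by (simp add: cong_def)
    then have "2 * n dvd ((n + 1) * (t * i) + n * int d) - ((n + 1) * (t * j) + n * int e)"
      by (simp add: cong_iff_dvd_diff)
    moreover have "((n + 1) * (t * i) + n * int d) - ((n + 1) * (t * j) + n * int e) =
        t * (i - j) + n * (t * (i - j) + int d - int e)"
      by (simp add: algebra_simps)
    ultimately have dv: "2 * n dvd t * (i - j) + n * (t * (i - j) + int d - int e)" by simp
    then have "n dvd t * (i - j) + n * (t * (i - j) + int d - int e)"
      using dvd_mult_right by blast
    then have "n dvd t * (i - j)" by (simp add: dvd_add_left_iff)
    then have "n dvd i - j"
      using assms(3) by (simp add: coprime_commute coprime_dvd_mult_right_iff)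
    then have "i = j" using ij by (metis cong_iff_dvd_diff cong_less_imp_eq_int)
    moreover from this dv have "2 dvd int d - int e" using assms(1) by simp
    then have "d = e" using de by auto
    ultimately show "i = j \<and> d = e" by simp
  qed
  moreover have "?F ` ({0..<n} \<times> {0, 1}) = {0..<2 * n}"
  proof (rule card_subset_eq)
    show "?F ` ({0..<n} \<times> {0, 1}) \<subseteq> {0..<2 * n}" using assms(1) by auto
    show "card (?F ` ({0..<n} \<times> {0, 1})) = card {0..<2 * n}"
      using inj assms(1) by (simp add: card_image nat_mult_distrib)
  qed simp
  ultimately show ?thesis by (simp add: bij_betw_def)
qed

lemma sum_crt_two:
  fixes f :: "int \<Rightarrow> 'a::comm_monoid_add" and n :: int
  assumes "n > 0" "odd n" and per: "\<And>i. f (i mod (2 * n)) = f i"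
  shows "(\<Sum>i\<in>{0..<2 * n}. f i) = (\<Sum>i\<in>{0..<n}. f ((n + 1) * i) + f ((n + 1) * i + n))"
proof -
  let ?F = "\<lambda>(i, d::nat). ((n + 1) * (1 * i) + n * int d) mod (2 * n)"
  have "bij_betw ?F ({0..<n} \<times> {0, 1}) {0..<2 * n}"
    by (rule bij_betw_crt_two) (use assms in simp_all)
  from sum.reindex_bij_betw[OF this, of f]
  have "(\<Sum>i\<in>{0..<2 * n}. f i) = (\<Sum>x\<in>{0..<n} \<times> {0, 1}. f (?F x))" by simp
  also have "\<dots> = (\<Sum>i\<in>{0..<n}. \<Sum>d\<in>{0, 1}. f (?F (i, d)))"
    unfolding sum.cartesian_product by (rule sum.cong) auto
  also have "\<dots> = (\<Sum>i\<in>{0..<n}. f ((n + 1) * i) + f ((n + 1) * i + n))"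
    by (simp add: per)
  finally show ?thesis .
qed

section \<open>Multipliers\<close>

text \<open>The coefficient of x^g in the image of \<open>P\<close> in Z[x]/(x^n - 1), the group
  ring of Z/n. Taking representatives in \<open>int poly\<close> gives a commutative ring in which
  q-th powers can be expanded.\<close>

definition residue_coeff :: "int \<Rightarrow> int poly \<Rightarrow> int \<Rightarrow> int" where
  "residue_coeff n P g = (\<Sum>i\<le>degree P. if [int i = g] (mod n) then coeff P i else 0)"

lemma residue_coeff_ge_degree:
  assumes "degree P \<le> N"
  shows "residue_coeff n P g = (\<Sum>i\<le>N. if [int i = g] (mod n) then coeff P i else 0)"
  unfolding residue_coeff_def
  by (rule sum.mono_neutral_left) (use assms in \<open>auto simp: coeff_eq_0\<close>)

lemma residue_coeff_0 [simp]: "residue_coeff n 0 g = 0"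
  unfolding residue_coeff_def by (rule sum.neutral) simp

lemma residue_coeff_add:
  "residue_coeff n (P + Q) g = residue_coeff n P g + residue_coeff n Q g"
proof -
  let ?N = "max (degree P) (degree Q)"
  show ?thesis
    by (simp add: residue_coeff_ge_degree[of _ ?N] degree_add_le_max sum.distrib [symmetric])
      (rule sum.cong; simp)
qed

lemma residue_coeff_sum:
  "residue_coeff n (\<Sum>i\<in>A. P i) g = (\<Sum>i\<in>A. residue_coeff n (P i) g)"
  by (induction A rule: infinite_finite_induct) (simp_all add: residue_coeff_add)

lemma residue_coeff_smult: "residue_coeff n (smult c P) g = c * residue_coeff n P g"
  by (simp add: residue_coeff_ge_degree[of _ "degree P"] degree_smult_le sum_distrib_left
      if_distrib cong: if_cong)

lemma residue_coeff_monom_mult: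
  "residue_coeff n (monom 1 k * P) g = residue_coeff n P (g - int k)"
proof -
  have "residue_coeff n (monom 1 k * P) g =
      (\<Sum>i\<le>degree P + k. if [int i = g] (mod n) then coeff (monom 1 k * P) i else 0)"
    by (rule residue_coeff_ge_degree) (metis add.commute degree_mult_le degree_monom_eq order_trans one_neq_zero)
  also have "\<dots> = (\<Sum>i\<in>{k..degree P + k}. if [int i = g] (mod n) then coeff P (i - k) else 0)"
    by (rule sum.mono_neutral_cong_right) (auto simp: coeff_monom_mult)
  also have "\<dots> = (\<Sum>i\<in>{0..degree P}. if [int (i + k) = g] (mod n) then coeff P i else 0)"
    using sum.shift_bounds_cl_nat_ivl[of "\<lambda>i. if [int i = g] (mod n) then coeff P (i - k) else 0" 0 k "degree P"]
    by (simp only: add_diff_cancel_right' add_0)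
  also have "\<dots> = residue_coeff n P (g - int k)"
    unfolding residue_coeff_def atMost_atLeast0
    by (intro sum.cong refl) (simp add: cong_iff_dvd_diff algebra_simps)
  finally show ?thesis .
qed

lemma residue_coeff_monom:
  "residue_coeff n (monom 1 k) g = of_bool [int k = g] (mod n)"
proof -
  have "residue_coeff n 1 g = of_bool [0 = g] (mod n)" for g
    by (simp add: residue_coeff_def)
  from this[of "g - int k"] show ?thesis
    using residue_coeff_monom_mult[of n k 1 g] by (simp add: cong_iff_dvd_diff)
qed

text \<open>The inner binomial coefficients of a prime row are multiples of \<open>q\<close>.
  Divisibility by \<open>of_nat q\<close> stands in for characteristic \<open>q\<close>, so that
  integer polynomials are covered.\<close>

lemma prime_dvd_add_power_minus:
  fixes x y :: "'a::comm_ring_1"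
  assumes "prime q"
  shows "of_nat q dvd (x + y) ^ q - (x ^ q + y ^ q)"
proof -
  have q: "q > 0" using assms prime_gt_0_nat by blast
  have "{..q} = {0, q} \<union> {0<..<q}" using q by auto
  then have "(x + y) ^ q = (\<Sum>k\<in>{0, q} \<union> {0<..<q}. of_nat (q choose k) * x ^ k * y ^ (q - k))"
    by (simp add: binomial_ring)
  also have "\<dots> = (x ^ q + y ^ q) + (\<Sum>k\<in>{0<..<q}. of_nat (q choose k) * x ^ k * y ^ (q - k))"
    using q by (subst sum.union_disjoint) auto
  finally have "(x + y) ^ q - (x ^ q + y ^ q) =
      (\<Sum>k\<in>{0<..<q}. of_nat (q choose k) * x ^ k * y ^ (q - k))" by simp
  also have "of_nat q dvd \<dots>"
  proof (rule dvd_sum)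
    fix k assume "k \<in> {0<..<q}"
    then have "q dvd (q choose k)" using assms by (intro dvd_choose_prime) auto
    then have "(of_nat q :: 'a) dvd of_nat (q choose k)" by (metis dvd_def of_nat_mult)
    then show "(of_nat q :: 'a) dvd of_nat (q choose k) * x ^ k * y ^ (q - k)"
      by (simp add: mult.assoc)
  qed
  finally show ?thesis .
qed

lemma prime_dvd_sum_power_minus:
  fixes f :: "'b \<Rightarrow> 'a::comm_ring_1"
  assumes "prime q" "finite A"
  shows "of_nat q dvd (\<Sum>i\<in>A. f i) ^ q - (\<Sum>i\<in>A. f i ^ q)"
  using assms(2)
proof (induction A rule: finite_induct)
  case empty
  have "q > 0" using assms prime_gt_0_nat by blast
  then show ?case by (simp add: zero_power)
next
  case (insert x A)
  have "(\<Sum>i\<in>insert x A. f i) ^ q - (\<Sum>i\<in>insert x A. f i ^ q) =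
     ((f x + sum f A) ^ q - (f x ^ q + sum f A ^ q)) + (sum f A ^ q - (\<Sum>i\<in>A. f i ^ q))"
    using insert by (simp add: algebra_simps)
  then show ?case
    using insert.IH prime_dvd_add_power_minus[OF assms(1)] by (metis dvd_add)
qed

section \<open>Multipliers of partial difference sets\<close>

text \<open>
  A periodic 0/1-function \<open>a\<close> is the element \<open>\<Sum>i. a i x\<^sup>i\<close> of the group ring of \<open>\<int>/n\<close>. If \<open>a * a\<close>
  is a combination of \<open>a\<close>, \<open>1\<close> and the all-one element, so is every power of \<open>a\<close>; and modulo a
  prime \<open>q\<close> the \<open>q\<close>-th power is \<open>\<Sum>i. a i x\<^sup>q\<^sup>i\<close>.
\<close>
lemma partial_difference_set_multiplier:
  fixes a :: "int \<Rightarrow> bool" and n c d e :: int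
  assumes n: "n > 0" and per: "\<And>i. a (i mod n) = a i"
    and conv: "\<And>g. conv n (\<lambda>i. of_bool (a i)) (\<lambda>i. of_bool (a i)) g =
      c + d * of_bool (a g) + e * of_bool (n dvd g)"
    and q: "prime q" "coprime (int q) n"
    and h: "\<not> n dvd h" "\<not> n dvd h'" "a (int q * h) = a (int q * h')"
  shows "a h = a h'"
proof -
  define P :: "int poly" where "P = (\<Sum>i\<in>{0..<n}. smult (of_bool (a i)) (monom 1 (nat i)))"
  define A :: "int \<Rightarrow> int" where "A = (\<lambda>i. of_bool (a i))"
  have perA: "A (i mod n) = A i" for i by (simp add: A_def per)
  have step: "residue_coeff n (P * Q) g = (\<Sum>i\<in>{0..<n}. A i * residue_coeff n Q (g - i))" for Q g
    by (simp add: P_def A_def sum_distrib_right residue_coeff_sum residue_coeff_smult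
        residue_coeff_monom_mult)
  define \<kappa> where "\<kappa> = (\<Sum>i\<in>{0..<n}. A i)"
  have dvd_sum: "(\<Sum>i\<in>{0..<n}. A i * of_bool (n dvd (g - i))) = A g" for g
    using conv_delta[of n A g, OF n perA] by (simp add: conv_def)
  have pow: "\<exists>u v w. \<forall>g. residue_coeff n (P ^ j) g = u * A g + v * of_bool (n dvd g) + w" for j
  proof (induction j)
    case 0
    show ?case
      by (rule exI[of _ 0], rule exI[of _ 1], rule exI[of _ 0])
        (use residue_coeff_monom[of n 0] in \<open>simp add: cong_iff_dvd_diff\<close>)
  next
    case (Suc j)
    then obtain u v w where IH: "\<And>g. residue_coeff n (P ^ j) g = u * A g + v * of_bool (n dvd g) + w"
      by blast
    \<comment> \<open>Convolution with \<open>A\<close> sends \<open>A\<close> to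
      \<open>c + d * A\<close> plus \<open>e\<close> times the identity, the identity to
      \<open>A\<close>, and the constant 1 to \<open>\<kappa>\<close>.\<close>
    have "residue_coeff n (P ^ Suc j) g =
        (u * d + v) * A g + u * e * of_bool (n dvd g) + (u * c + w * \<kappa>)" for g
    proof -
      have "residue_coeff n (P ^ Suc j) g =
          (\<Sum>i\<in>{0..<n}. u * (A i * A (g - i)) + v * (A i * of_bool (n dvd (g - i))) + w * A i)"
        by (simp add: step IH algebra_simps)
      also have "\<dots> = u * conv n A A g + v * A g + w * \<kappa>"
        by (simp add: sum.distrib sum_distrib_left [symmetric] dvd_sum conv_def \<kappa>_def)
      also have "conv n A A g = c + d * A g + e * of_bool (n dvd g)"
        using conv[of g] by (simp add: A_def)
      finally show ?thesis by (simp add: algebra_simps)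
    qed
    then show ?case by blast
  qed
  then obtain u v w
    where uvw: "\<And>g. residue_coeff n (P ^ q) g = u * A g + v * of_bool (n dvd g) + w" by blast
  define R where "R = (\<Sum>i\<in>{0..<n}. smult (of_bool (a i)) (monom 1 (nat i)) ^ q :: int poly)"
  have q0: "q > 0" using q prime_gt_0_nat by blast
  have "R = (\<Sum>i\<in>{0..<n}. smult (of_bool (a i)) (monom 1 (nat i * q)))"
    unfolding R_def using q0 by (intro sum.cong) (simp_all add: monom_power)
  then have R: "residue_coeff n R g = (\<Sum>i\<in>{0..<n}. A i * of_bool (n dvd (int q * i - g)))" for g
    by (simp add: residue_coeff_sum residue_coeff_smult residue_coeff_monom A_def
        cong_iff_dvd_diff mult.commute)
  \<comment> \<open>As \<open>q\<close> is a unit modulo \<open>n\<close>, the exponent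
    \<open>q * i\<close> falls into the class of \<open>q * g\<close> only for \<open>i\<close> in
    the class of \<open>g\<close>.\<close>
  have Rq: "residue_coeff n R (int q * g) = A g" for g
  proof -
    have "n dvd (int q * i - int q * g) \<longleftrightarrow> n dvd (g - i)" for i
      using q(2) by (metis coprime_commute coprime_dvd_mult_right_iff dvd_diff_commute right_diff_distrib)
    then show ?thesis using dvd_sum[of g] by (simp add: R)
  qed
  have "of_nat q dvd P ^ q - R"
    unfolding P_def R_def by (rule prime_dvd_sum_power_minus[OF q(1)]) simp
  then obtain T where T: "P ^ q = R + smult (int q) T"
    by (auto simp: of_nat_poly elim!: dvdE) (metis add.commute diff_add_cancel)
  \<comment> \<open>Comparing the two expressions for the q-th power at \<open>q * g\<close> shows
    that, off 0, \<open>A g\<close> modulo \<open>q\<close> depends only on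
    \<open>A (q * g)\<close>.\<close>
  have *: "int q dvd u * A (int q * g) + w - A g" if "\<not> n dvd g" for g
  proof -
    have "\<not> n dvd int q * g"
      using that q(2) by (metis coprime_commute coprime_dvd_mult_right_iff)
    then show ?thesis
      using uvw[of "int q * g"] Rq[of g]
      by (simp add: T residue_coeff_add residue_coeff_smult) (metis add_diff_cancel_left' dvd_triv_left)
  qed
  \<comment> \<open>The difference is -1, 0 or 1, so divisibility by \<open>q > 1\<close> makes it
    vanish.\<close>
  have "int q dvd A h' - A h"
    using dvd_diff[OF *[OF h(1)] *[OF h(2)]] h(3) by (simp add: A_def)
  moreover have "int q > 1" using q(1) prime_gt_1_nat by simp
  ultimately show ?thesis
    by (auto simp: A_def of_bool_def split: if_splits)
qed

text \<open>The residue of \<open>t\<close> in \<open>{1..<p}\<close> is a product of primes other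
  than \<open>p\<close>, and these factors are cancelled one at a time.\<close>

lemma all_multipliers:
  fixes a :: "int \<Rightarrow> bool" and p :: nat
  assumes p: "prime p" and per: "\<And>i. a (i mod int p) = a i"
    and mult: "\<And>q h h'. \<lbrakk>prime q; q \<noteq> p; \<not> int p dvd h; \<not> int p dvd h'; a (int q * h) = a (int q * h')\<rbrakk>
      \<Longrightarrow> a h = a h'"
    and t: "\<not> int p dvd t" and h: "\<not> int p dvd h" "\<not> int p dvd h'" "a (t * h) = a (t * h')"
  shows "a h = a h'"
proof -
  have pp: "prime (int p)" using p by simp
  have nat_mult: "\<lbrakk>\<not> p dvd s; \<not> int p dvd h; \<not> int p dvd h'; a (int s * h) = a (int s * h')\<rbrakk> \<Longrightarrow> a h = a h'"
    for s h h'
  proof (induction s arbitrary: h h' rule: less_induct)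
    case (less s)
    show ?case
    proof (cases "s = 1")
      case True
      with less.prems show ?thesis by simp
    next
      case False
      then obtain q where q: "prime q" "q dvd s" by (meson prime_factor_nat)
      then obtain s' where s: "s = q * s'" by (elim dvdE)
      with less.prems(1) have ns: "\<not> p dvd s'" "q \<noteq> p" by auto
      then have "s' > 0" by (metis dvd_0_right gr0I)
      then have "s' < s" using s prime_gt_1_nat[OF q(1)] by simp
      moreover have "\<not> int p dvd int s' * h" "\<not> int p dvd int s' * h'"
        using ns(1) less.prems(2,3) pp by (simp_all add: prime_dvd_mult_iff)
      then have "a (int s' * h) = a (int s' * h')"
        by (rule mult[OF q(1) ns(2)]) (use less.prems(4) in \<open>simp add: s mult.assoc\<close>)
      ultimately show ?thesis using less.IH[of s' h h'] ns(1) less.prems by blast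
    qed
  qed
  have pos: "int p > 0" using p prime_gt_0_nat by simp
  have red: "a (int (nat (t mod int p)) * x) = a (t * x)" for x
    by (rule periodic_mod_cong[of a "int p", OF per]) (use pos in \<open>simp add: cong_def mod_simps\<close>)
  show ?thesis
  proof (rule nat_mult[of "nat (t mod int p)"])
    show "\<not> p dvd nat (t mod int p)"
    proof
      assume "p dvd nat (t mod int p)"
      then have "int p dvd t mod int p" using pos by (metis int_dvd_int_iff nat_0_le pos_mod_sign)
      then show False using t by (simp add: dvd_mod_iff)
    qed
  qed (use h red in auto)
qed

text \<open>
  The multipliers that fix \<open>a\<close> form a subgroup of index two of the multiplicative group modulo \<open>p\<close>.
\<close>
lemma quadratic_residues_of_multipliers:
  fixes a :: "int \<Rightarrow> bool" and p :: nat
  assumes p: "prime p" "odd p" and per: "\<And>i. a (i mod int p) = a i"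
    and mult: "\<And>t h h'. \<lbrakk>\<not> int p dvd t; \<not> int p dvd h; \<not> int p dvd h'; a (t * h) = a (t * h')\<rbrakk>
      \<Longrightarrow> a h = a h'"
    and h1: "\<not> int p dvd h1" "a h1" and h0: "\<not> int p dvd h0" "\<not> a h0"
  shows "2 * (\<Sum>i\<in>{0..<int p}. of_bool (\<not> int p dvd i \<and> a i)) = int p - 1"
    and "\<not> int p dvd h \<Longrightarrow> a (h1 * h) \<longleftrightarrow> (\<exists>y. [h = y * y] (mod int p))"
proof -
  let ?n = "int p"
  have pp: "prime ?n" using p by simp
  have pos: "?n > 1" using p prime_gt_1_nat by simp
  have cop: "coprime t ?n" if "\<not> ?n dvd t" for t
    using that pp by (metis coprime_commute prime_imp_coprime)
  have ndvd: "\<not> ?n dvd s * t" if "\<not> ?n dvd s" "\<not> ?n dvd t" for s t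
    using that pp by (simp add: prime_dvd_mult_iff)
  define F :: "int \<Rightarrow> int" where "F i = of_bool (\<not> ?n dvd i \<and> a i)" for i
  have perF: "F (i mod ?n) = F i" for i
    by (simp add: F_def per dvd_mod_iff)
  obtain u where u: "[h1 * u = 1] (mod ?n)"
    using cong_solve_coprime_int[OF cop[OF h1(1)]] by blast
  \<comment> \<open>A multiplier carrying \<open>h1\<close>, which satisfies \<open>a\<close>, to
    \<open>h0\<close>, which does not; \<open>flip\<close> below shows that it exchanges
    \<open>a\<close> with its complement off 0.\<close>
  define t where "t = u * h0"
  have t: "[t * h1 = h0] (mod ?n)"
    using cong_mult[OF u cong_refl[of h0]] by (simp add: t_def mult_ac)
  then have nt: "\<not> ?n dvd t"
    using h0(1) by (metis cong_dvd_iff dvd_mult2)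
  have ath1: "a (t * h1) = a h0" by (rule periodic_mod_cong[of a ?n, OF per t])
  \<comment> \<open>Applying \<open>mult\<close> to an inverse \<open>r\<close> of \<open>s\<close>
    gives the converse of cancellation.\<close>
  have mult_iff: "a (s * x) = a (s * y) \<longleftrightarrow> a x = a y"
    if s: "\<not> ?n dvd s" and xy: "\<not> ?n dvd x" "\<not> ?n dvd y" for s x y
  proof
    assume eq: "a x = a y"
    obtain r where "[s * r = 1] (mod ?n)"
      using cong_solve_coprime_int[OF cop[OF s]] by blast
    then have r: "[r * (s * z) = z] (mod ?n)" for z
      using cong_mult[OF _ cong_refl[of z], of "s * r" 1 ?n] by (simp add: mult_ac)
    then have nr: "\<not> ?n dvd r"
      using xy(1) by (metis cong_dvd_iff dvd_mult2)
    have "a (r * (s * x)) = a (r * (s * y))"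
      using eq periodic_mod_cong[of a ?n, OF per r] by simp
    then show "a (s * x) = a (s * y)"
      by (rule mult[OF nr ndvd[OF s xy(1)] ndvd[OF s xy(2)]])
  qed (rule mult[OF s xy])
  have flip: "a (t * x) \<longleftrightarrow> \<not> a x" if "\<not> ?n dvd x" for x
    using mult_iff[OF nt that h1(1)] ath1 h0(2) h1(2) by blast
  have "(\<Sum>i\<in>{0..<?n}. F i) + (\<Sum>i\<in>{0..<?n}. F i) = (\<Sum>i\<in>{0..<?n}. F (t * i) + F i)"
    using sum_periodic_affine[of ?n t F 0] cop[OF nt] perF pos by (simp add: sum.distrib)
  \<comment> \<open>By \<open>flip\<close>, exactly one of \<open>i\<close> and \<open>t * i\<close>
    satisfies \<open>a\<close> when \<open>i\<close> is nonzero.\<close>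
  also have "\<dots> = (\<Sum>i\<in>{0..<?n}. of_bool (i \<noteq> 0))"
  proof (rule sum.cong[OF refl])
    fix i assume i: "i \<in> {0..<?n}"
    then have "i \<noteq> 0 \<longleftrightarrow> \<not> ?n dvd i" using zdvd_not_zless[of i ?n] by (cases "i = 0") auto
    then show "F (t * i) + F i = of_bool (i \<noteq> 0)"
      using flip[of i] ndvd[OF nt, of i] by (auto simp: F_def)
  qed
  also have "\<dots> = ?n - 1"
  proof -
    have "{0..<?n} \<inter> {i. i \<noteq> 0} = {1..<?n}" by auto
    then show ?thesis using pos by simp
  qed
  finally show half: "2 * (\<Sum>i\<in>{0..<?n}. of_bool (\<not> ?n dvd i \<and> a i)) = ?n - 1"
    by (simp add: F_def)
  \<comment> \<open>Multiplication by \<open>y\<close> either preserves \<open>a\<close> off 0 or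
    negates it; doing it twice preserves it in both cases.\<close>
  have square: "a (y * y * x) = a x" if "\<not> ?n dvd y" "\<not> ?n dvd x" for x y
    using mult_iff[of y "y * x" x] ndvd that by (auto simp: mult.assoc)
  define Q where "Q = {i \<in> {1..<?n}. \<exists>y. [i = y * y] (mod ?n)}"
  define B where "B = {i \<in> {1..<?n}. a (h1 * i)}"
  have nd: "\<not> ?n dvd i" if "i \<in> {1..<?n}" for i
    using that zdvd_not_zless[of i ?n] by auto
  have "Q \<subseteq> B"
  proof
    fix i assume "i \<in> Q"
    then obtain y where i: "i \<in> {1..<?n}" and y: "[i = y * y] (mod ?n)" by (auto simp: Q_def)
    have "\<not> ?n dvd y" using nd[OF i] cong_dvd_iff[OF y] by auto
    then have "a (y * y * h1)" using square h1 by blast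
    moreover have "[h1 * i = y * y * h1] (mod ?n)"
      using cong_mult[OF cong_refl[of h1] y] by (simp add: mult_ac)
    ultimately have "a (h1 * i)" using periodic_mod_cong[of a ?n, OF per] by blast
    with i show "i \<in> B" by (simp add: B_def)
  qed
  obtain m where m: "?n = 2 * m + 1" using p(2) by (metis even_of_nat oddE)
  have "(\<Sum>i\<in>{0..<?n}. F (h1 * i)) = (\<Sum>i\<in>{0..<?n}. F i)"
    using sum_periodic_affine[of ?n h1 F 0] cop[OF h1(1)] perF pos by simp
  then have "(\<Sum>i\<in>{0..<?n}. F (h1 * i)) = m"
    using half m by (simp add: F_def)
  moreover have "{0..<?n} \<inter> {i. \<not> ?n dvd h1 * i \<and> a (h1 * i)} = B"
  proof -
    have "i \<in> {1..<?n} \<longleftrightarrow> i \<in> {0..<?n} \<and> \<not> ?n dvd h1 * i" for i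
      using nd[of i] ndvd[OF h1(1), of i] by (cases "i = 0") auto
    then show ?thesis unfolding B_def by blast
  qed
  ultimately have cB: "int (card B) = m" by (simp add: F_def)
  have finQ: "finite Q" "finite B" by (rule finite_subset[of _ "{1..<?n}"]; force simp: Q_def B_def)+
  \<comment> \<open>This gives at least \<open>m\<close> squares, while \<open>B\<close> contains
    them all and has only \<open>m\<close> elements, so \<open>Q = B\<close>. The squares of
    \<open>1..m\<close> are distinct because \<open>y + z\<close> lies strictly between 0 and
    \<open>2 * m + 1\<close>.\<close>
  have "inj_on (\<lambda>y. y * y mod ?n) {1..m}"
  proof (rule inj_onI)
    fix y z assume yz: "y \<in> {1..m}" "z \<in> {1..m}" "y * y mod ?n = z * z mod ?n"
    then have "?n dvd (y + z) * (y - z)" by (simp add: mod_eq_dvd_iff algebra_simps)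
    moreover have "\<not> ?n dvd y + z" using nd[of "y + z"] yz m by simp
    ultimately have "?n dvd y - z" using pp by (simp add: prime_dvd_mult_iff)
    then have "[y = z] (mod ?n)" by (simp add: cong_iff_dvd_diff)
    then show "y = z" using yz m by (intro cong_less_imp_eq_int) auto
  qed
  moreover have "(\<lambda>y. y * y mod ?n) ` {1..m} \<subseteq> Q"
  proof
    fix x assume "x \<in> (\<lambda>y. y * y mod ?n) ` {1..m}"
    then obtain y where y: "y \<in> {1..m}" "x = y * y mod ?n" by blast
    then have "\<not> ?n dvd y * y" using nd[of y] ndvd m by simp
    then have "x \<noteq> 0" using y(2) by (simp add: dvd_eq_mod_eq_0)
    moreover have "0 \<le> x" "x < ?n" using y(2) pos by simp_all
    moreover have "[x = y * y] (mod ?n)" using y(2) by (simp add: cong_def)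
    ultimately show "x \<in> Q" unfolding Q_def by auto
  qed
  ultimately have "card {1..m} \<le> card Q" by (rule card_inj_on_le[OF _ _ finQ(1)])
  then have "card B \<le> card Q" using cB by simp
  then have QB: "Q = B" by (rule card_seteq[OF finQ(2) \<open>Q \<subseteq> B\<close>])
  assume h: "\<not> ?n dvd h"
  have "h mod ?n \<noteq> 0" using h by (simp add: dvd_eq_mod_eq_0)
  moreover have "0 \<le> h mod ?n" "h mod ?n < ?n" using pos by simp_all
  ultimately have "h mod ?n \<in> {1..<?n}" by auto
  then have "a (h1 * (h mod ?n)) \<longleftrightarrow> (\<exists>y. [h mod ?n = y * y] (mod ?n))"
    using arg_cong[OF QB, of "\<lambda>S. h mod ?n \<in> S"] unfolding Q_def B_def by blast
  moreover have "a (h1 * (h mod ?n)) = a (h1 * h)"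
    by (rule periodic_mod_cong[of a ?n, OF per]) (simp add: cong_def mod_simps)
  ultimately show "a (h1 * h) \<longleftrightarrow> (\<exists>y. [h = y * y] (mod ?n))"
    by simp
qed

section \<open>Symmetric subsets of \<open>\<int>/p\<close>\<close>

lemma conv_add_left: "conv n (\<lambda>i. f i + f' i) h g = conv n f h g + conv n f' h g"
  by (simp add: conv_def sum.distrib algebra_simps)

lemma conv_add_right: "conv n f (\<lambda>i. h i + h' i) g = conv n f h g + conv n f h' g"
  by (simp add: conv_def sum.distrib algebra_simps)

lemma conv_bool_pos:
  assumes "n > 0" and per: "\<And>i. a (i mod n) = a i" "\<And>i. b (i mod n) = b i"
    and "a i" "b j"
  shows "0 < conv n (\<lambda>i. of_bool (a i)) (\<lambda>i. of_bool (b i)) (i + j)"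
proof -
  have "b (i + j - i mod n) = b j"
    by (rule periodic_mod_cong[of b n, OF per(2)]) (simp add: cong_def mod_simps)
  then have "0 < of_bool (a (i mod n)) * (of_bool (b (i + j - i mod n)) :: int)"
    using assms by simp
  also have "\<dots> \<le> conv n (\<lambda>i. of_bool (a i)) (\<lambda>i. of_bool (b i)) (i + j)"
    unfolding conv_def
    by (rule member_le_sum[of _ _ "\<lambda>k. of_bool (a k) * of_bool (b (i + j - k))"]) (use assms(1) in auto)
  finally show ?thesis .
qed

lemma multiples_cover_prime:
  fixes g x n :: int
  assumes "prime n" "\<not> n dvd g"
  shows "\<exists>k::nat. [int k * g = x] (mod n)"
proof -
  have "coprime g n" using assms by (metis coprime_commute prime_imp_coprime)
  then obtain u where u: "[g * u = 1] (mod n)" using cong_solve_coprime_int by blast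
  have n: "n > 0" using assms(1) prime_gt_0_int by blast
  have "[int (nat (u * x mod n)) * g = (u * x) * g] (mod n)"
    using n by (simp add: cong_def mod_simps)
  also have "[(u * x) * g = 1 * x] (mod n)"
    using cong_mult[OF u cong_refl[of x]] by (simp add: mult_ac)
  finally show ?thesis unfolding mult_1 by blast
qed

text \<open>Equality would make the symmetric set \<open>a\<close> invariant under translation by
  \<open>g\<close>. As \<open>g\<close> generates Z/n for prime \<open>n\<close>, the set would be
  empty or everything.\<close>

lemma conv_self_less:
  assumes n: "prime n" and per: "\<And>i. a (i mod n) = a i" and sym: "\<And>i. a (- i) = a i"
    and g: "\<not> n dvd g" and xy: "a x" "\<not> a y"
  shows "conv n (\<lambda>i. of_bool (a i)) (\<lambda>i. of_bool (a i)) g < (\<Sum>i\<in>{0..<n}. of_bool (a i))"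
proof (rule ccontr)
  assume "\<not> ?thesis"
  moreover have "conv n (\<lambda>i. of_bool (a i)) (\<lambda>i. of_bool (a i)) g \<le> (\<Sum>i\<in>{0..<n}. of_bool (a i))"
    unfolding conv_def by (rule sum_mono) simp
  ultimately have eq: "(\<Sum>i\<in>{0..<n}. of_bool (a i) * of_bool (a (g - i))) = (\<Sum>i\<in>{0..<n}. of_bool (a i) :: int)"
    by (simp add: conv_def)
  have pos: "n > 0" using n prime_gt_0_int by blast
  have step: "a (i - g)" if "a i" for i
  proof -
    have "of_bool (a (i mod n)) * of_bool (a (g - i mod n)) = (of_bool (a (i mod n)) :: int)"
      using sum_mono_inv[OF eq, of "i mod n"] pos by simp
    then have "a (g - i mod n)" using that per by simp
    then have "a (- (g - i mod n))" using sym[of "g - i mod n"] by simp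
    moreover have "a (- (g - i mod n)) = a (i - g)"
      by (rule periodic_mod_cong[of a n, OF per]) (simp add: cong_def mod_simps)
    ultimately show ?thesis by simp
  qed
  have iter: "a (x - int k * g)" for k
  proof (induction k)
    case (Suc k)
    then show ?case using step[OF Suc.IH] by (simp add: algebra_simps)
  qed (use xy in simp)
  obtain k where "[int k * g = x - y] (mod n)" using multiples_cover_prime[OF n g] by blast
  then have "[x - int k * g = x - (x - y)] (mod n)" by (rule cong_diff[OF cong_refl])
  then have "[x - int k * g = y] (mod n)" by simp
  then show False using iter[of k] periodic_mod_cong[of a n, OF per] xy by blast
qed

lemma exists_half_mod:
  fixes n g :: int
  assumes "odd n"
  obtains h where "[2 * h = g] (mod n)"
proof -
  obtain m where "n = 2 * m + 1" using assms by (elim oddE)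
  \<comment> \<open>\<open>m + 1\<close> is the inverse of 2 modulo
    \<open>2 * m + 1\<close>.\<close>
  then have "2 * (g * (m + 1)) - g = n * g" by (simp add: algebra_simps)
  then have "[2 * (g * (m + 1)) = g] (mod n)" by (simp add: cong_iff_dvd_diff)
  then show thesis by (rule that)
qed

text \<open>
  By parity, either \<open>c\<close> vanishes off \<open>0\<close>, or doubling preserves \<open>c\<close>, and then \<open>c\<close> is the indicator
  function of a subgroup.
\<close>
lemma conv_self_two_values:
  fixes c :: "int \<Rightarrow> bool" and \<gamma> :: int and p :: nat
  assumes p: "prime p" "odd p" and per: "\<And>i. c (i mod int p) = c i" and c0: "c 0"
    and vals: "\<And>g. \<not> int p dvd g \<Longrightarrow>
      conv (int p) (\<lambda>i. of_bool (c i)) (\<lambda>i. of_bool (c i)) g \<in> {0, \<gamma>}"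
    and x: "c x" "\<not> int p dvd x"
  shows "c y"
proof -
  let ?n = "int p"
  let ?r = "conv ?n (\<lambda>i. of_bool (c i)) (\<lambda>i. of_bool (c i))"
  have pp: "prime ?n" using p by simp
  have pos: "?n > 0" "odd ?n" using p prime_gt_0_nat by simp_all
  have n2: "?n dvd 2 * h \<longleftrightarrow> ?n dvd h" for h
    using coprime_dvd_mult_right_iff[of ?n 2 h] pos(2) by simp
  note per_cong = periodic_mod_cong[of c ?n, OF per]
  have cdvd: "c g" if "?n dvd g" for g
    using per_cong[of g 0] that c0 by (simp add: cong_0_iff)
  have parity: "even (?r (2 * h)) \<longleftrightarrow> \<not> c h" for h
    using conv_self_parity[OF pos, of c h] per by auto
  have odd: "odd \<gamma>"
  proof -
    have "?r (2 * x) \<in> {0, \<gamma>}" by (rule vals) (simp add: n2 x(2))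
    moreover have "odd (?r (2 * x))" using parity[of x] x(1) by blast
    ultimately show ?thesis by (metis dvd_0_right insert_iff singletonD)
  qed
  \<comment> \<open>Writing \<open>2 * h\<close> as \<open>0 + 2 * h\<close> makes the count at
    \<open>2 * h\<close> positive, hence equal to the odd number \<open>\<gamma>\<close>; parity
    then puts \<open>h\<close> in \<open>c\<close>.\<close>
  have halve: "c h" if "c (2 * h)" for h
  proof (cases "?n dvd h")
    case False
    have "0 < ?r (0 + 2 * h)"
      by (rule conv_bool_pos) (use pos per c0 that in auto)
    then have "?r (2 * h) = \<gamma>" using vals[of "2 * h"] n2 False by simp
    then show ?thesis using parity[of h] odd by simp
  qed (rule cdvd)
  have halve_iter: "c (2 ^ j * h) \<Longrightarrow> c h" for j h
  proof (induction j)
    case (Suc j)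
    then show ?case using halve[of "2 ^ j * h"] by (simp add: mult.assoc)
  qed simp
  \<comment> \<open>By Fermat, \<open>2 ^ (p - 2) * (2 * h)\<close> is congruent to
    \<open>h\<close>, so repeated halving leads from \<open>h\<close> to
    \<open>2 * h\<close>.\<close>
  have double: "c (2 * h)" if "c h" for h
  proof (rule halve_iter[of "p - 2"])
    have p2: "p \<ge> 3" using p prime_ge_2_nat[OF p(1)] by (cases "p = 2") auto
    have "[2 ^ (p - 1) = 1] (mod p)"
      by (rule fermat_theorem[OF p(1)]) (use p2 in \<open>auto dest: dvd_imp_le\<close>)
    then have "[2 ^ (p - 1) = (1::int)] (mod ?n)"
      using cong_int_iff[of "2 ^ (p - 1)" 1 p] by simp
    then have "[2 ^ (p - 1) * h = 1 * h] (mod ?n)" by (rule cong_mult[OF _ cong_refl])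
    then have "c (2 ^ (p - 1) * h)" using per_cong that by (metis mult_1)
    moreover have "p - 1 = Suc (p - 2)" using p2 by simp
    ultimately show "c (2 ^ (p - 2) * (2 * h))" by (simp add: mult_ac)
  qed
  \<comment> \<open>The count at \<open>i + j\<close> is positive, hence odd, so half of
    \<open>i + j\<close> lies in \<open>c\<close>, and doubling returns to
    \<open>i + j\<close>.\<close>
  have add: "c (i + j)" if "c i" "c j" for i j
  proof (cases "?n dvd i + j")
    case False
    obtain h where h: "[2 * h = i + j] (mod ?n)" using exists_half_mod pos(2) by blast
    have "0 < ?r (i + j)"
      by (rule conv_bool_pos) (use pos per that in auto)
    then have "?r (i + j) = \<gamma>" using vals[OF False] by simp
    moreover have "?r (2 * h) = ?r (i + j)"
      using periodic_mod_cong[of ?r ?n, OF conv_periodic h] per by simp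
    ultimately have "c h" using odd parity[of h] by simp
    then show ?thesis using double per_cong[OF h] by blast
  qed (rule cdvd)
  have mult: "c (int k * x)" for k
  proof (induction k)
    case (Suc k)
    then show ?case using add[OF x(1) Suc.IH] by (simp add: algebra_simps)
  qed (simp add: c0)
  obtain k where "[int k * x = y] (mod ?n)" using multiples_cover_prime[OF pp x(2)] by blast
  then show ?thesis using mult per_cong by blast
qed

section \<open>Connection sets as pairs of subsets of Z/p\<close>

text \<open>
  Under \<open>\<int>/2p \<cong> \<int>/p \<times> \<int>/2\<close> a connection set becomes a pair \<open>(a, b)\<close> of subsets of \<open>\<int>/p\<close>. The numbers
  of common neighbours of two vertices at difference \<open>(g, 0)\<close> and \<open>(g, 1)\<close> are \<open>r\<^sub>0 g\<close> and \<open>r\<^sub>1 g\<close>;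
  the assumption \<open>diam\<close> says that non-adjacent vertices at difference \<open>(g, 1)\<close> have a common neighbour.
\<close>
locale symmetric_pair =
  fixes p :: nat and a b :: "int \<Rightarrow> bool"
  assumes p: "prime p" "odd p"
    and per_a: "\<And>i. a (i mod int p) = a i" and per_b: "\<And>i. b (i mod int p) = b i"
    and sym_a: "\<And>i. a (- i) = a i" and sym_b: "\<And>i. b (- i) = b i"
    and a0: "\<not> a 0"
begin

definition A :: "int \<Rightarrow> int" where "A = (\<lambda>i. of_bool (a i))"

definition B :: "int \<Rightarrow> int" where "B = (\<lambda>i. of_bool (b i))"

definition r\<^sub>0 :: "int \<Rightarrow> int" where "r\<^sub>0 g = conv (int p) A A g + conv (int p) B B g"

definition r\<^sub>1 :: "int \<Rightarrow> int" where "r\<^sub>1 g = 2 * conv (int p) A B g"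

definition \<kappa> :: int where "\<kappa> = (\<Sum>i\<in>{0..<int p}. A i)"

end

text \<open>The strictly Deza conditions expressed in Z/p. A difference \<open>(g, 1)\<close> is
  never zero, so \<open>r\<^sub>1\<close> contributes all its values and \<open>r\<^sub>0\<close>
  only those off 0.\<close>

locale deza_pair = symmetric_pair +
  fixes \<alpha> \<beta> :: int
  assumes r_values: "r\<^sub>0 ` {g. \<not> int p dvd g} \<union> range r\<^sub>1 = {\<alpha>, \<beta>}" and le: "\<alpha> \<le> \<beta>"
    and not_srg: "\<nexists>l m. (\<forall>g. \<not> int p dvd g \<longrightarrow> r\<^sub>0 g = (if a g then l else m)) \<and>
      (\<forall>g. r\<^sub>1 g = (if b g then l else m))"
    and diam: "\<And>g. \<not> b g \<Longrightarrow> 0 < r\<^sub>1 g"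
begin

lemma pos: "int p > 0" and prime_int: "prime (int p)" and odd_int: "odd (int p)"
  using p prime_gt_0_nat by simp_all

lemma dvd_double_iff: "int p dvd 2 * h \<longleftrightarrow> int p dvd h"
  using coprime_dvd_mult_right_iff[of "int p" 2 h] p by simp

lemma per_A: "A (i mod int p) = A i" and per_B: "B (i mod int p) = B i"
  by (simp_all add: A_def B_def per_a per_b)

lemma not_a_dvd: "int p dvd g \<Longrightarrow> \<not> a g"
  using periodic_mod_cong[of a "int p" g 0] per_a a0 by (simp add: cong_0_iff)

lemma b_dvd: "int p dvd g \<Longrightarrow> b g = b 0"
  using periodic_mod_cong[of b "int p" g 0] per_b by (simp add: cong_0_iff)

lemma r0_vals: "\<not> int p dvd g \<Longrightarrow> r\<^sub>0 g = \<alpha> \<or> r\<^sub>0 g = \<beta>"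
  using r_values by blast

lemma r1_vals: "r\<^sub>1 g = \<alpha> \<or> r\<^sub>1 g = \<beta>"
  using r_values by blast

lemma conv_AA_0: "conv (int p) A A 0 = \<kappa>"
  unfolding conv_def \<kappa>_def by (rule sum.cong) (auto simp: A_def sym_a)

lemma \<kappa>_nonneg: "0 \<le> \<kappa>"
  by (simp add: \<kappa>_def A_def sum_nonneg)

lemma a_empty: "(\<And>g. \<not> a g) \<Longrightarrow> r\<^sub>1 g = 0"
  by (simp add: r\<^sub>1_def conv_def A_def)

lemma conv_b_full:
  assumes "\<And>g. b g"
  shows "conv (int p) A B g = \<kappa>" "conv (int p) B B g = int p"
  using assms pos by (simp_all add: conv_def B_def \<kappa>_def)

text \<open>Summing the constant convolution over Z/p gives \<open>p\<close> times it as |A| |B|, so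
  \<open>p\<close> divides |A| or |B|. If \<open>b\<close> failed somewhere, both sizes would be
  below \<open>p\<close>, and nonzero because \<open>diam\<close> makes the constant
  positive.\<close>

lemma r1_constant_imp_b_full:
  assumes const: "\<And>g. r\<^sub>1 g = r\<^sub>1 0"
  shows "b g"
proof (rule ccontr)
  assume g: "\<not> b g"
  have c: "conv (int p) A B h = conv (int p) A B 0" for h
    using const[of h] by (simp add: r\<^sub>1_def)
  have c_pos: "0 < conv (int p) A B 0"
    using diam[OF g] const[of g] by (simp add: r\<^sub>1_def)
  have eq: "int p * conv (int p) A B 0 = \<kappa> * (\<Sum>i\<in>{0..<int p}. B i)"
  proof -
    have "(\<Sum>h\<in>{0..<int p}. conv (int p) A B h) = \<kappa> * (\<Sum>i\<in>{0..<int p}. B i)"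
      unfolding \<kappa>_def by (rule sum_conv[of "int p" B A, OF pos per_B])
    moreover have "(\<Sum>h\<in>{0..<int p}. conv (int p) A B h) = (\<Sum>h\<in>{0..<int p}. conv (int p) A B 0)"
      by (rule sum.cong[OF refl c])
    ultimately show ?thesis using pos by simp
  qed
  then have nz: "\<kappa> \<noteq> 0" "(\<Sum>i\<in>{0..<int p}. B i) \<noteq> 0"
    using c_pos pos by auto
  have lt: "(\<Sum>i\<in>{0..<int p}. of_bool (c i)) < int p" if "\<not> c x" "x \<in> {0..<int p}" for c x
  proof -
    have "(\<Sum>i\<in>{0..<int p}. of_bool (c i)) < (\<Sum>i\<in>{0..<int p}. 1 :: int)"
    proof (rule sum_strict_mono_ex1)
      show "\<exists>i\<in>{0..<int p}. of_bool (c i) < (1 :: int)" using that by (intro bexI[of _ x]) simp_all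
    qed simp_all
    then show ?thesis by simp
  qed
  have lt_a: "\<kappa> < int p"
    unfolding \<kappa>_def A_def by (rule lt[of a 0]) (use pos a0 in simp_all)
  have lt_b: "(\<Sum>i\<in>{0..<int p}. B i) < int p"
    unfolding B_def by (rule lt[of b "g mod int p"]) (use pos g per_b in simp_all)
  have "int p dvd \<kappa> \<or> int p dvd (\<Sum>i\<in>{0..<int p}. B i)"
    using prime_int eq by (metis dvd_triv_left prime_dvd_mult_iff)
  then show False
  proof
    assume "int p dvd \<kappa>"
    then show False using zdvd_not_zless[of \<kappa> "int p"] \<kappa>_nonneg nz lt_a by simp
  next
    assume "int p dvd (\<Sum>i\<in>{0..<int p}. B i)"
    moreover have "0 \<le> (\<Sum>i\<in>{0..<int p}. B i)" by (simp add: B_def sum_nonneg)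
    ultimately show False
      using zdvd_not_zless[of "\<Sum>i\<in>{0..<int p}. B i" "int p"] nz(2) lt_b by simp
  qed
qed

lemma r1_not_constant: "\<exists>g. r\<^sub>1 g \<noteq> r\<^sub>1 0"
proof (rule ccontr)
  assume "\<not> ?thesis"
  then have b: "b g" for g using r1_constant_imp_b_full by blast
  define c where "c i \<longleftrightarrow> \<not> a i" for i
  let ?C = "\<lambda>i. of_bool (c i)"
  have r1: "r\<^sub>1 g = 2 * \<kappa>" for g
    by (simp add: r\<^sub>1_def conv_b_full b)
  have r0: "r\<^sub>0 g = conv (int p) ?C ?C g + 2 * \<kappa>" for g
  proof -
    have C: "?C = (\<lambda>i. 1 - A i)" by (auto simp: c_def A_def)
    have "(\<Sum>i\<in>{0..<int p}. A (g - i)) = \<kappa>"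
      using sum_periodic_affine[of "int p" "-1" A g] pos per_A by (simp add: \<kappa>_def algebra_simps)
    then have "conv (int p) ?C ?C g = int p - 2 * \<kappa> + conv (int p) A A g"
      by (simp add: C conv_def \<kappa>_def algebra_simps sum.distrib sum_subtractf)
    then show ?thesis by (simp add: r\<^sub>0_def conv_b_full b)
  qed
  \<comment> \<open>Both \<open>r\<^sub>0 g\<close> and \<open>2 * \<kappa>\<close> lie in
    \<open>{\<alpha>, \<beta>}\<close>, so their difference is 0 or this number.\<close>
  define \<gamma> where "\<gamma> = \<alpha> + \<beta> - 4 * \<kappa>"
  have vals: "conv (int p) ?C ?C g \<in> {0, \<gamma>}" if "\<not> int p dvd g" for g
    using r0_vals[OF that] r1_vals[of 0] r0[of g] r1[of 0] by (auto simp: \<gamma>_def)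
  show False
  \<comment> \<open>The complement \<open>c\<close> is either all of Z/p, so that \<open>a\<close>
    is empty, or just 0. In both cases adjacency determines the counts, against
    \<open>not_srg\<close>.\<close>
  proof (cases "\<exists>x. c x \<and> \<not> int p dvd x")
    case True
    then obtain x where x: "c x" "\<not> int p dvd x" by blast
    have "c y" for y
      by (rule conv_self_two_values[OF p _ _ vals x]) (auto simp: c_def per_a a0)
    then have na: "\<not> a y" for y by (simp add: c_def)
    then have "r\<^sub>0 g = int p" "r\<^sub>1 g = 0" for g
      using a_empty by (auto simp: r\<^sub>0_def conv_b_full b) (simp add: conv_def A_def)
    then show False using not_srg na b by auto
  next
    case False
    have "conv (int p) ?C ?C g = 0" if "\<not> int p dvd g" for g
      unfolding conv_def
    proof (rule sum.neutral, rule ballI)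
      fix i
      show "of_bool (c i) * of_bool (c (g - i)) = (0::int)"
        using False that dvd_add[of "int p" i "g - i"] by auto
    qed
    then have "r\<^sub>0 g = 2 * \<kappa>" if "\<not> int p dvd g" for g using r0 that by simp
    then have "(\<forall>g. \<not> int p dvd g \<longrightarrow> r\<^sub>0 g = (if a g then 2 * \<kappa> else 2 * \<kappa>)) \<and>
        (\<forall>g. r\<^sub>1 g = (if b g then 2 * \<kappa> else 2 * \<kappa>))"
      using r1 by simp
    then show False using not_srg by blast
  qed
qed

section \<open>Parity and the comparison of the two subsets\<close>

lemma even_values: "even \<alpha>" "even \<beta>"
proof -
  \<comment> \<open>Being non-constant, \<open>r\<^sub>1\<close> takes both values, and it is twice
    a convolution.\<close>
  obtain g where "r\<^sub>1 g \<noteq> r\<^sub>1 0" using r1_not_constant by blast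
  moreover have "even (r\<^sub>1 g)" "even (r\<^sub>1 0)" by (simp_all add: r\<^sub>1_def)
  ultimately show "even \<alpha>" "even \<beta>" using r1_vals[of g] r1_vals[of 0] by auto
qed

lemma a_nonempty: "\<exists>x. a x"
  using a_empty r1_not_constant by force

lemma b_not_full: "\<exists>y. \<not> b y"
  using conv_b_full(1) r1_not_constant by (force simp: r\<^sub>1_def)

lemma parity_A: "even (conv (int p) A A (2 * h) - A h)"
  unfolding A_def by (rule conv_self_parity[of "int p" a, OF pos odd_int per_a])

lemma parity_B: "even (conv (int p) B B (2 * h) - B h)"
  unfolding B_def by (rule conv_self_parity[of "int p" b, OF pos odd_int per_b])

lemma a_eq_b:
  assumes "\<not> int p dvd h"
  shows "a h = b h"
proof -
  have "\<not> int p dvd 2 * h" using assms by (simp add: dvd_double_iff)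
  then have "even (r\<^sub>0 (2 * h))" using r0_vals even_values by metis
  then have "even (A h + B h)"
    using parity_A[of h] parity_B[of h] unfolding r\<^sub>0_def by presburger
  then show ?thesis by (auto simp: A_def B_def of_bool_def split: if_splits)
qed

lemma conv_AA_less: "\<not> int p dvd g \<Longrightarrow> conv (int p) A A g < \<kappa>"
  using a_nonempty conv_self_less[of "int p" a, OF prime_int per_a sym_a _ _ a0] by (auto simp: A_def \<kappa>_def)

text \<open>Otherwise \<open>a = b\<close>. The value \<open>2 * \<kappa>\<close> at 0 is not
  attained off 0, where the convolution is therefore constant; parity makes \<open>a\<close>
  constant off 0 as well, and this describes a complete multipartite graph.\<close>

lemma b_0: "b 0"
proof (rule ccontr)
  assume b0: "\<not> b 0"
  have ab: "a = b"
  proof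
    fix g show "a g = b g"
      using a_eq_b b_dvd not_a_dvd b0 by (cases "int p dvd g") auto
  qed
  have AB: "B = A" by (subst A_def, subst B_def) (simp add: ab)
  have r0: "r\<^sub>0 g = 2 * conv (int p) A A g" and r1: "r\<^sub>1 g = 2 * conv (int p) A A g" for g
    by (simp_all add: r\<^sub>0_def r\<^sub>1_def AB)
  have r10: "r\<^sub>1 0 = 2 * \<kappa>" by (simp add: r1 conv_AA_0)
  \<comment> \<open>The Deza parameter other than \<open>r\<^sub>1 0 = 2 * \<kappa>\<close>.\<close>
  define c where "c = \<alpha> + \<beta> - 2 * \<kappa>"
  have c: "2 * conv (int p) A A g = c" if "\<not> int p dvd g" for g
    using conv_AA_less[OF that] r0_vals[OF that] r1_vals[of 0] by (auto simp: r0 r10 c_def)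
  have same: "a h = a h'" if "\<not> int p dvd h" "\<not> int p dvd h'" for h h'
  proof -
    have "2 * conv (int p) A A (2 * h) = 2 * conv (int p) A A (2 * h')"
      using c that dvd_double_iff by simp
    then have "even (A h - A h')" using parity_A[of h] parity_A[of h'] by presburger
    then show ?thesis by (auto simp: A_def)
  qed
  obtain x where "a x" using a_nonempty by blast
  then have a_iff: "a g \<longleftrightarrow> \<not> int p dvd g" for g
    using same[of g x] not_a_dvd by blast
  then have b_iff: "b g \<longleftrightarrow> \<not> int p dvd g" for g using ab by metis
  have "r\<^sub>1 g = 2 * \<kappa>" if "int p dvd g" for g
  proof -
    have "conv (int p) A A g = conv (int p) A A 0"
      using periodic_mod_cong[of "conv (int p) A A" "int p" g 0] conv_periodic[of A "int p" A] per_A that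
      by (simp add: cong_0_iff)
    then show ?thesis using r1 r10 by metis
  qed
  then have "(\<forall>g. \<not> int p dvd g \<longrightarrow> r\<^sub>0 g = (if a g then c else 2 * \<kappa>)) \<and>
      (\<forall>g. r\<^sub>1 g = (if b g then c else 2 * \<kappa>))"
    using c by (simp add: a_iff b_iff r0 r1)
  then show False using not_srg by blast
qed

section \<open>The remaining case B = A + 1 in the group ring\<close>

lemma b_iff: "b g \<longleftrightarrow> a g \<or> int p dvd g"
  using a_eq_b b_dvd b_0 by blast

lemma B_eq: "B = (\<lambda>i. A i + of_bool (int p dvd i))"
  unfolding A_def B_def using b_iff not_a_dvd by (intro ext) auto

lemma conv_AB: "conv (int p) A B g = conv (int p) A A g + A g"
  by (simp add: B_eq conv_add_right conv_delta[of "int p" A, OF pos per_A])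

text \<open>The square of \<open>A + 1\<close>. With \<open>conv_AB\<close> it shows that
  \<open>r\<^sub>0\<close> and \<open>r\<^sub>1\<close> agree off 0.\<close>

lemma conv_BB: "conv (int p) B B g = conv (int p) A A g + 2 * A g + of_bool (int p dvd g)"
proof -
  have "conv (int p) B B g = conv (int p) A B g + conv (int p) (\<lambda>i. of_bool (int p dvd i)) B g"
    by (subst (1) B_eq) (rule conv_add_left)
  also have "conv (int p) (\<lambda>i. of_bool (int p dvd i)) B g = conv (int p) B (\<lambda>i. of_bool (int p dvd i)) g"
    by (rule conv_commute[OF pos]) (simp_all add: per_B dvd_mod_iff)
  also have "\<dots> = B g" by (rule conv_delta[of "int p" B, OF pos per_B])
  finally show ?thesis using B_eq conv_AB[of g] by simp
qed

lemma sum_of_bool_dvd: "(\<Sum>i\<in>{0..<int p}. of_bool (int p dvd i)) = (1 :: int)"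
proof -
  have "(\<Sum>i\<in>{0..<int p}. of_bool (int p dvd i)) = (\<Sum>i\<in>{0::int}. 1 :: int)"
  proof (rule sum.mono_neutral_cong_right)
    show "\<forall>i\<in>{0..<int p} - {0}. of_bool (int p dvd i) = (0 :: int)"
      using zdvd_not_zless by force
  qed (use pos in auto)
  then show ?thesis by simp
qed

lemma sum_B: "(\<Sum>i\<in>{0..<int p}. B i) = \<kappa> + 1"
  by (simp add: B_eq sum.distrib \<kappa>_def sum_of_bool_dvd)

text \<open>Off 0, \<open>conv_AB\<close> is the square of \<open>A\<close> where \<open>a\<close>
  fails, and one less than the square of \<open>B\<close> where \<open>a\<close> holds. Strictness
  of the self-convolution bound for \<open>a\<close> and for \<open>b\<close>, with |B| =
  \<open>\<kappa> + 1\<close>, settles the two cases.\<close>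

lemma conv_AB_less:
  assumes "\<not> int p dvd g"
  shows "conv (int p) A B g < \<kappa>"
proof (cases "a g")
  case True
  obtain y where "\<not> b y" using b_not_full by blast
  then have "conv (int p) B B g < (\<Sum>i\<in>{0..<int p}. B i)"
    using conv_self_less[of "int p" b, OF prime_int per_b sym_b assms b_0] by (simp add: B_def)
  also have "\<dots> = \<kappa> + 1" by (rule sum_B)
  finally have "conv (int p) B B g < \<kappa> + 1" .
  moreover have "A g = 1" using True by (simp add: A_def)
  ultimately show ?thesis using assms conv_AB[of g] conv_BB[of g] by simp
next
  case False
  then have "A g = 0" by (simp add: A_def)
  then show ?thesis using conv_AA_less[OF assms] conv_AB[of g] by simp
qed

lemma conv_AB_0: "conv (int p) A B 0 = \<kappa>"
  by (simp add: conv_AB conv_AA_0) (simp add: A_def a0)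

text \<open>\<open>r\<^sub>1 0 = 2 * \<kappa>\<close> is one parameter and exceeds every value off
  0, so it is \<open>\<beta>\<close> and all values off 0 equal \<open>\<alpha>\<close>. The
  identity has the shape required by \<open>partial_difference_set_multiplier\<close>.\<close>

lemma values_of_kappa:
  "\<exists>c. (\<forall>g. conv (int p) A A g = c + (- 1) * A g + (\<kappa> - c) * of_bool (int p dvd g)) \<and>
    \<alpha> = 2 * c \<and> \<beta> = 2 * \<kappa>"
proof -
  have r0: "r\<^sub>0 g = 2 * conv (int p) A B g" if "\<not> int p dvd g" for g
    using that by (simp add: r\<^sub>0_def conv_AB conv_BB)
  have r10: "r\<^sub>1 0 = 2 * \<kappa>" by (simp add: r\<^sub>1_def conv_AB_0)
  have one: "\<not> int p dvd 1" using p prime_gt_1_nat[of p] by simp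
  have \<alpha>: "2 * conv (int p) A B g = \<alpha>" and \<beta>: "\<beta> = 2 * \<kappa>" if "\<not> int p dvd g" for g
    using conv_AB_less[OF that] r0_vals[OF that] r0[OF that] r10 r1_vals[of 0] le by auto
  define c where "c = conv (int p) A B 1"
  have c: "conv (int p) A B g = c" if "\<not> int p dvd g" for g
    using \<alpha>[OF that] \<alpha>[OF one] by (simp add: c_def)
  have "conv (int p) A B g = \<kappa>" if "int p dvd g" for g
  proof -
    have "conv (int p) A B g = conv (int p) A B 0"
      using periodic_mod_cong[of "conv (int p) A B" "int p" g 0] conv_periodic[of B "int p" A] per_B that
      by (simp add: cong_0_iff)
    then show ?thesis by (simp add: conv_AB_0)
  qed
  with c have "conv (int p) A A g = c + (- 1) * A g + (\<kappa> - c) * of_bool (int p dvd g)" for g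
    using conv_AB[of g] by (cases "int p dvd g") auto
  moreover have "\<alpha> = 2 * c" "\<beta> = 2 * \<kappa>"
    using \<alpha>[OF one] \<beta>[OF one] by (simp_all add: c_def)
  ultimately show ?thesis by blast
qed

text \<open>All units are multipliers, so \<open>a\<close> is the set of squares or of non-squares.
  Taking for \<open>t\<close> any element of \<open>a\<close> treats both alike.\<close>

lemma paley_structure:
  "\<exists>c t. int p = 4 * c + 1 \<and> \<alpha> = 2 * c \<and> \<beta> = 4 * c \<and> \<kappa> = 2 * c \<and> \<not> int p dvd t \<and>
    (\<forall>h. \<not> int p dvd h \<longrightarrow> (a (t * h) \<longleftrightarrow> (\<exists>y. [h = y * y] (mod int p))))"
proof -
  obtain c where conv: "\<And>g. conv (int p) A A g = c + (- 1) * A g + (\<kappa> - c) * of_bool (int p dvd g)"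
    and \<alpha>: "\<alpha> = 2 * c" and \<beta>: "\<beta> = 2 * \<kappa>"
    using values_of_kappa by blast
  have prime_mult: "a h = a h'" if "prime q" "q \<noteq> p" "\<not> int p dvd h" "\<not> int p dvd h'"
    "a (int q * h) = a (int q * h')" for q h h'
  proof (rule partial_difference_set_multiplier[OF pos per_a conv[unfolded A_def] that(1) _ that(3-)])
    show "coprime (int q) (int p)" using that p by (simp add: primes_coprime)
  qed
  have mult: "a h = a h'" if "\<not> int p dvd t" "\<not> int p dvd h" "\<not> int p dvd h'" "a (t * h) = a (t * h')"
    for t h h'
    by (rule all_multipliers[OF p(1) per_a prime_mult that])
  obtain x where x: "a x" using a_nonempty by blast
  then have nx: "\<not> int p dvd x" using not_a_dvd by blast
  obtain y where "\<not> b y" using b_not_full by blast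
  then have y: "\<not> a y" "\<not> int p dvd y" by (simp_all add: b_iff)
  have quad: "a (x * h) \<longleftrightarrow> (\<exists>y. [h = y * y] (mod int p))" if "\<not> int p dvd h" for h
    by (rule quadratic_residues_of_multipliers(2)[OF p per_a _ nx x y(2,1) that]) (rule mult)
  have card: "2 * (\<Sum>i\<in>{0..<int p}. of_bool (\<not> int p dvd i \<and> a i)) = int p - 1"
    by (rule quadratic_residues_of_multipliers(1)[OF p per_a _ nx x y(2,1)]) (rule mult)
  have "(\<Sum>i\<in>{0..<int p}. of_bool (\<not> int p dvd i \<and> a i)) = \<kappa>"
    unfolding \<kappa>_def A_def using not_a_dvd by (intro sum.cong) auto
  then have half: "2 * \<kappa> = int p - 1" using card by simp
  \<comment> \<open>Summing the identity for the square of \<open>A\<close> over Z/p gives |A|^2 =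
    (p - 1) c; with 2 |A| = p - 1 this yields |A| = 2c and p = 4c + 1.\<close>
  have "\<kappa> * \<kappa> = (\<Sum>g\<in>{0..<int p}. c + (- 1) * A g + (\<kappa> - c) * of_bool (int p dvd g))"
    using sum_conv[of "int p" A A, OF pos per_A] by (simp only: conv \<kappa>_def)
  also have "\<dots> = int p * c - \<kappa> + (\<kappa> - c) * (\<Sum>g\<in>{0..<int p}. of_bool (int p dvd g))"
    by (simp add: sum.distrib sum_distrib_left \<kappa>_def sum_subtractf)
  also have "(\<Sum>i\<in>{0..<int p}. of_bool (int p dvd i)) = (1 :: int)"
    by (rule sum_of_bool_dvd)
  finally have "\<kappa> * \<kappa> = (int p - 1) * c" by (simp add: algebra_simps)
  then have "\<kappa> * \<kappa> = 2 * \<kappa> * c" by (simp add: half)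
  then have "\<kappa> * (\<kappa> - 2 * c) = 0" by (simp add: right_diff_distrib)
  moreover have "\<kappa> > 0" using half p prime_gt_1_nat[of p] by simp
  ultimately have "\<kappa> = 2 * c" by simp
  then have "int p = 4 * c + 1 \<and> \<alpha> = 2 * c \<and> \<beta> = 4 * c \<and> \<kappa> = 2 * c"
    using \<alpha> \<beta> half by simp
  moreover have "\<forall>h. \<not> int p dvd h \<longrightarrow> (a (x * h) \<longleftrightarrow> (\<exists>y. [h = y * y] (mod int p)))"
    using quad by blast
  ultimately show ?thesis using nx by blast
qed

end

section \<open>Circulants as symmetric subsets of \<open>\<int>/n\<close>\<close>

lemma pair_wf_digraph_cayley_graph: "pair_wf_digraph (cayley_graph G S)"
  by unfold_locales (auto simp: cayley_graph_def)

lemma cyclic_group_int_param: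
  fixes G (structure)
  assumes "group G" "cyclic_group G" "card (carrier G) = n" "n > 0"
  obtains x where "x \<in> carrier G" "bij_betw (\<lambda>i::int. x [^] i) {0..<int n} (carrier G)"
    "\<And>i::int. x [^] (i mod int n) = x [^] i"
proof -
  interpret group G by fact
  obtain x where x: "x \<in> carrier G" and gen: "carrier G = range (\<lambda>i::int. x [^] i)"
    using assms(2) by (auto simp: cyclic_group)
  have per: "x [^] (i mod int n) = x [^] i" for i :: int
  proof -
    have "x [^] (int n * (i div int n)) = (x [^] n) [^] (i div int n)"
      by (simp add: int_pow_pow[OF x, symmetric] int_pow_int)
    also have "x [^] n = \<one>"
      using pow_order_eq_1[OF x] assms(3) by (simp add: Coset.order_def)
    finally have "x [^] (int n * (i div int n)) = \<one>" by (simp add: int_pow_one)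
    moreover have "x [^] i = x [^] (int n * (i div int n)) \<otimes> x [^] (i mod int n)"
      by (subst int_pow_mult[OF x, symmetric]) simp
    ultimately show ?thesis using x by simp
  qed
  have img: "(\<lambda>i::int. x [^] i) ` {0..<int n} = carrier G"
  proof
    show "carrier G \<subseteq> (\<lambda>i::int. x [^] i) ` {0..<int n}"
    proof
      fix y assume "y \<in> carrier G"
      then obtain i :: int where "y = x [^] i" using gen by blast
      then have "y = x [^] (i mod int n)" by (simp add: per)
      then show "y \<in> (\<lambda>i::int. x [^] i) ` {0..<int n}" using assms(4) by (intro image_eqI) auto
    qed
  qed (use x in auto)
  then have "inj_on (\<lambda>i::int. x [^] i) {0..<int n}"
    using assms(3) by (intro eq_card_imp_inj_on) simp_all
  with img x per show thesis by (intro that[of x]) (simp_all add: bij_betw_def)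
qed

text \<open>The labelling \<open>f\<close> is constrained only on \<open>{0..<n}\<close>, hence the
  later form \<open>f (i mod int n)\<close>; the connection set becomes a periodic predicate on
  exponents of a generator.\<close>

locale circulant_param =
  fixes \<Gamma> :: "'v pair_pre_digraph" and n :: nat and f :: "int \<Rightarrow> 'v" and s :: "int \<Rightarrow> bool"
  assumes graph: "pair_graph \<Gamma>"
    and n_pos: "n > 0"
    and bij: "bij_betw f {0..<int n} (pverts \<Gamma>)"
    and per: "\<And>i. s (i mod int n) = s i"
    and sym: "\<And>i. s (- i) = s i"
    and s0: "\<not> s 0"
    and adj: "\<And>i j. \<lbrakk>i \<in> {0..<int n}; j \<in> {0..<int n}\<rbrakk> \<Longrightarrow> (f i, f j) \<in> parcs \<Gamma> \<longleftrightarrow> s (i - j)"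

lemma circulant_imp_param:
  fixes \<Gamma> :: "'v pair_pre_digraph"
  assumes circ: "circulant TYPE('g) \<Gamma>" and \<Gamma>: "pair_graph \<Gamma>" "card (pverts \<Gamma>) = n" "n > 0"
  shows "\<exists>f s. circulant_param \<Gamma> n f s"
proof -
  interpret \<Gamma>: pair_graph \<Gamma> by fact
  obtain G :: "'g monoid" and S where G: "group G" "cyclic_group G" "connection_set G S"
    and iso: "digraph_iso (with_proj \<Gamma>) (with_proj (cayley_graph G S))"
    using circ unfolding circulant_def by blast
  interpret group G by fact
  obtain h where h: "bij_betw h (pverts \<Gamma>) (carrier G)"
    and h_adj: "\<And>u v. \<lbrakk>u \<in> pverts \<Gamma>; v \<in> pverts \<Gamma>\<rbrakk> \<Longrightarrow>
      (u, v) \<in> parcs \<Gamma> \<longleftrightarrow> (h u, h v) \<in> parcs (cayley_graph G S)"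
    using iso[unfolded digraph_iso_with_proj_iff[OF \<Gamma>.pair_wf_digraph_axioms pair_wf_digraph_cayley_graph]]
    by (auto simp: cayley_graph_def)
  have "card (carrier G) = n" using bij_betw_same_card[OF h] \<Gamma>(2) by simp
  then obtain x where x: "x \<in> carrier G" and e: "bij_betw (\<lambda>i::int. x [^]\<^bsub>G\<^esub> i) {0..<int n} (carrier G)"
    and x_per: "\<And>i::int. x [^]\<^bsub>G\<^esub> (i mod int n) = x [^]\<^bsub>G\<^esub> i"
    using cyclic_group_int_param[OF G(1,2) _ \<Gamma>(3)] by metis
  define f where "f = (\<lambda>i::int. the_inv_into (pverts \<Gamma>) h (x [^]\<^bsub>G\<^esub> i))"
  define s where "s = (\<lambda>i::int. x [^]\<^bsub>G\<^esub> i \<in> S)"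
  have hf: "h (f i) = x [^]\<^bsub>G\<^esub> i" for i
    unfolding f_def by (rule f_the_inv_into_f_bij_betw[OF h]) (use x in simp)
  have bij: "bij_betw f {0..<int n} (pverts \<Gamma>)"
    using bij_betw_trans[OF e bij_betw_the_inv_into[OF h]] by (simp add: f_def comp_def)
  have "circulant_param \<Gamma> n f s"
  proof
    show "s (- i) = s i" for i
    proof -
      have S: "set_inv\<^bsub>G\<^esub> S = S" and sub: "S \<subseteq> carrier G" using G(3) by (simp_all add: connection_set_def)
      have "inv\<^bsub>G\<^esub> y \<in> S" if "y \<in> S" for y
        using that S by (force simp: SET_INV_def)
      then have "s (- i)" if "s i" for i
        using that x by (simp add: s_def int_pow_neg)
      from this[of i] this[of "- i"] show ?thesis by auto
    qed
    show "\<not> s 0" using G(3) by (simp add: s_def connection_set_def)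
    show "(f i, f j) \<in> parcs \<Gamma> \<longleftrightarrow> s (i - j)" if "i \<in> {0..<int n}" "j \<in> {0..<int n}" for i j
    proof -
      have "f i \<in> pverts \<Gamma>" "f j \<in> pverts \<Gamma>" using bij that by (auto simp: bij_betw_def)
      then show ?thesis
        using x by (simp add: h_adj hf cayley_graph_def s_def int_pow_diff)
    qed
  qed (use \<Gamma> bij x_per in \<open>simp_all add: s_def\<close>)
  then show ?thesis by blast
qed

section \<open>Common neighbours as a function of the difference\<close>

context circulant_param
begin

lemma vert: "f (i mod int n) \<in> pverts \<Gamma>"
  using bij n_pos by (auto simp: bij_betw_def)

lemma adj_mod: "(f (i mod int n), f (j mod int n)) \<in> parcs \<Gamma> \<longleftrightarrow> s (i - j)"
proof -
  have "s (i mod int n - j mod int n) = s (i - j)"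
    by (rule periodic_mod_cong[of s "int n", OF per]) (simp add: cong_def mod_simps)
  then show ?thesis using adj[of "i mod int n" "j mod int n"] n_pos by simp
qed

lemma adj_left:
  assumes "l \<in> {0..<int n}"
  shows "(f (i mod int n), f l) \<in> parcs \<Gamma> \<longleftrightarrow> s (i - l)"
  using adj_mod[of i l] assms by simp

lemma vert_cases:
  assumes "u \<in> pverts \<Gamma>"
  obtains i where "u = f (i mod int n)"
proof -
  obtain i where "i \<in> {0..<int n}" "u = f i"
    using assms bij_betw_imp_surj_on[OF bij] by (metis imageE)
  then have "u = f (i mod int n)" by simp
  then show thesis by (rule that)
qed

lemma f_mod_eq_iff: "f (i mod int n) = f (j mod int n) \<longleftrightarrow> int n dvd i - j"
proof -
  have "f (i mod int n) = f (j mod int n) \<longleftrightarrow> i mod int n = j mod int n"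
    by (rule inj_on_eq_iff[of f "{0..<int n}"]) (use bij n_pos in \<open>auto simp: bij_betw_def\<close>)
  then show ?thesis by (simp add: mod_eq_dvd_iff)
qed

lemma card_vertex_set:
  "int (card {w \<in> pverts \<Gamma>. P w}) = (\<Sum>i\<in>{0..<int n}. of_bool (P (f i)))"
proof -
  have "{w \<in> pverts \<Gamma>. P w} = f ` ({0..<int n} \<inter> {i. P (f i)})"
    using bij by (auto simp: bij_betw_def)
  moreover have "inj_on f ({0..<int n} \<inter> {i. P (f i)})"
    using bij by (auto simp: bij_betw_def intro: inj_on_subset)
  ultimately show ?thesis by (simp add: card_image)
qed

definition r :: "int \<Rightarrow> int" where
  "r g = conv (int n) (\<lambda>i. of_bool (s i)) (\<lambda>i. of_bool (s i)) g"

lemma card_common_neighbours: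
  "int (card (common_neighbours \<Gamma> (f (i mod int n)) (f (j mod int n)))) = r (i - j)"
proof -
  have "int (card (common_neighbours \<Gamma> (f (i mod int n)) (f (j mod int n)))) =
      (\<Sum>l\<in>{0..<int n}. of_bool ((f (i mod int n), f l) \<in> parcs \<Gamma> \<and> (f (j mod int n), f l) \<in> parcs \<Gamma>))"
    unfolding common_neighbours_def by (rule card_vertex_set)
  also have "\<dots> = (\<Sum>l\<in>{0..<int n}. of_bool (s (i - l)) * of_bool (s (j - l)))"
    by (intro sum.cong refl) (simp only: adj_left of_bool_conj)
  \<comment> \<open>Prepares the substitution \<open>l\<close> to \<open>i - l\<close>; symmetry of
    \<open>s\<close> turns \<open>s (j - l)\<close> into \<open>s (l - j)\<close>.\<close>
  also have "\<dots> = (\<Sum>l\<in>{0..<int n}. of_bool (s (- 1 * l + i)) * of_bool (s (i - j - (- 1 * l + i))))"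
    by (intro sum.cong refl) (use sym[of "j - l" for l] in simp)
  also have "\<dots> = r (i - j)"
    unfolding r_def conv_def
  proof (rule sum_periodic_affine)
    fix k
    have "s (i - j - k mod int n) = s (i - j - k)"
      by (rule periodic_mod_cong[of s "int n", OF per]) (simp add: cong_def mod_simps)
    then show "of_bool (s (k mod int n)) * of_bool (s (i - j - k mod int n)) =
        (of_bool (s k) * of_bool (s (i - j - k)) :: int)"
      by (simp add: per)
  qed (use n_pos in simp_all)
  finally show ?thesis .
qed

lemma out_degree_eq: "int (out_degree (with_proj \<Gamma>) (f (i mod int n))) = (\<Sum>l\<in>{0..<int n}. of_bool (s l))"
proof -
  interpret pair_graph \<Gamma> by (rule graph)
  have "out_arcs (with_proj \<Gamma>) (f (i mod int n)) =
      Pair (f (i mod int n)) ` {w \<in> pverts \<Gamma>. (f (i mod int n), w) \<in> parcs \<Gamma>}"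
    using wellformed' by (auto simp: out_arcs_def)
  then have "int (out_degree (with_proj \<Gamma>) (f (i mod int n))) =
      int (card {w \<in> pverts \<Gamma>. (f (i mod int n), w) \<in> parcs \<Gamma>})"
    by (simp add: out_degree_def card_image inj_on_def)
  also have "\<dots> = (\<Sum>l\<in>{0..<int n}. of_bool (s (- 1 * l + i)))"
    unfolding card_vertex_set
    by (intro sum.cong refl) (simp add: adj_left)
  also have "\<dots> = (\<Sum>l\<in>{0..<int n}. of_bool (s l))"
    by (rule sum_periodic_affine) (use n_pos per in simp_all)
  finally show ?thesis .
qed

end

text \<open>Distance is an infimum over walks; being at most 2, it forces a walk of length below 3.
  Lengths 0 and 1 are excluded, and the middle vertex of a walk of length 2 is a common
  neighbour.\<close>

lemma diameter_2_imp_common_neighbour: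
  assumes "pair_graph \<Gamma>" "diameter \<Gamma> = 2" and uv: "u \<in> pverts \<Gamma>" "v \<in> pverts \<Gamma>" "u \<noteq> v" "(u, v) \<notin> parcs \<Gamma>"
  shows "common_neighbours \<Gamma> u v \<noteq> {}"
proof -
  interpret pair_graph \<Gamma> by fact
  have "\<mu> (\<lambda>_. 1) u v \<le> 2"
    using uv assms(2) unfolding diameter_def by (metis SUP_upper order_trans)
  moreover have "\<not> (\<forall>q. awalk u q v \<longrightarrow> 3 \<le> ereal (awalk_cost (\<lambda>_. 1) q))"
  proof
    assume "\<forall>q. awalk u q v \<longrightarrow> 3 \<le> ereal (awalk_cost (\<lambda>_. 1) q)"
    then have "3 \<le> \<mu> (\<lambda>_. 1) u v" unfolding \<mu>_def by (auto intro: INF_greatest)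
    then have "(3 :: ereal) \<le> 2" using \<open>\<mu> (\<lambda>_. 1) u v \<le> 2\<close> by (rule order_trans)
    then show False by simp
  qed
  then obtain q where q: "awalk u q v" "\<not> 3 \<le> ereal (awalk_cost (\<lambda>_. 1) q)" by blast
  have "awalk_cost (\<lambda>_. 1) q = real (length q)" by (induction q) simp_all
  with q(2) have "length q < 3" by simp
  moreover have "length q \<noteq> 0" using q(1) uv(3) by (auto simp: awalk_Nil_iff)
  moreover have "length q \<noteq> 1"
  proof
    assume "length q = 1"
    then obtain e where "q = [e]" by (auto simp: length_Suc_conv)
    then have "e \<in> parcs \<Gamma>" "fst e = u" "snd e = v" using q(1) by (auto simp: awalk_Cons_iff awalk_Nil_iff)
    then show False using uv(4) by (cases e) simp
  qed
  ultimately have "length q = 2" by linarith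
  then obtain d e where "q = [d, e]" by (auto simp: length_Suc_conv numeral_2_eq_2)
  then have "d \<in> parcs \<Gamma>" "e \<in> parcs \<Gamma>" "fst d = u" "snd d = fst e" "snd e = v"
    using q(1) by (auto simp: awalk_Cons_iff awalk_Nil_iff)
  then have "(u, fst e) \<in> parcs \<Gamma>" "(fst e, v) \<in> parcs \<Gamma>" by (metis prod.collapse)+
  moreover from this have "(v, fst e) \<in> parcs \<Gamma>" using arcs_symmetric by blast
  ultimately show ?thesis using wellformed' unfolding common_neighbours_def by blast
qed

context circulant_param
begin

lemma strictly_deza_r:
  assumes "strictly_deza \<Gamma> n k b a"
  shows "r ` {g. \<not> int n dvd g} = {int a, int b}" "a \<le> b"
    and "int k = (\<Sum>l\<in>{0..<int n}. of_bool (s l))"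
    and "\<nexists>l m. \<forall>g. \<not> int n dvd g \<longrightarrow> r g = (if s g then l else m)"
    and "\<And>g. \<lbrakk>\<not> int n dvd g; \<not> s g\<rbrakk> \<Longrightarrow> 0 < r g"
proof -
  have deza: "deza_graph \<Gamma> n k b a" and diam: "diameter \<Gamma> = 2"
    and not_srg: "\<not> strongly_regular \<Gamma> n' k' l m" for n' k' l m
    using assms by (auto simp: strictly_deza_def)
  have reg: "regular_graph \<Gamma> n k" and ab: "a \<le> b"
    and vals: "{card (common_neighbours \<Gamma> u v) | u v. u \<in> pverts \<Gamma> \<and> v \<in> pverts \<Gamma> \<and> u \<noteq> v} = {a, b}"
    using deza by (auto simp: deza_graph_def)
  show "a \<le> b" by (rule ab)
  have "r ` {g. \<not> int n dvd g} = int ` {a, b}"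
  proof (intro equalityI subsetI)
    fix y assume "y \<in> r ` {g. \<not> int n dvd g}"
    then obtain g where g: "\<not> int n dvd g" "y = r g" by blast
    moreover have "f (g mod int n) \<noteq> f (0 mod int n)" using f_mod_eq_iff[of g 0] g by simp
    ultimately have "card (common_neighbours \<Gamma> (f (g mod int n)) (f (0 mod int n))) \<in> {a, b}"
      unfolding vals[symmetric] using vert by blast
    then show "y \<in> int ` {a, b}" using card_common_neighbours[of g 0] g by auto
  next
    fix y assume "y \<in> int ` {a, b}"
    then obtain u v where uv: "u \<in> pverts \<Gamma>" "v \<in> pverts \<Gamma>" "u \<noteq> v" "y = int (card (common_neighbours \<Gamma> u v))"
      unfolding vals[symmetric] by blast
    obtain i where i: "u = f (i mod int n)" using uv(1) by (rule vert_cases)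
    obtain j where j: "v = f (j mod int n)" using uv(2) by (rule vert_cases)
    have "y = r (i - j)" using card_common_neighbours[of i j] uv(4) i j by simp
    moreover have "\<not> int n dvd i - j" using f_mod_eq_iff[of i j] i j uv(3) by simp
    ultimately show "y \<in> r ` {g. \<not> int n dvd g}" by blast
  qed
  then show "r ` {g. \<not> int n dvd g} = {int a, int b}" by simp
  have "out_degree (with_proj \<Gamma>) (f (0 mod int n)) = k"
    using reg vert[of 0] unfolding regular_graph_def by blast
  then show "int k = (\<Sum>l\<in>{0..<int n}. of_bool (s l))"
    using out_degree_eq[of 0] by metis
  show "\<nexists>l m. \<forall>g. \<not> int n dvd g \<longrightarrow> r g = (if s g then l else m)"
  proof
    assume "\<exists>l m. \<forall>g. \<not> int n dvd g \<longrightarrow> r g = (if s g then l else m)"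
    then obtain l m where lm: "\<And>g. \<not> int n dvd g \<Longrightarrow> r g = (if s g then l else m)" by blast
    \<comment> \<open>The integers \<open>l\<close> and \<open>m\<close> can be negative only if no
      pair of the corresponding kind exists, so \<open>nat\<close> changes no actual count.\<close>
    have card: "card (common_neighbours \<Gamma> u v) = (if (u, v) \<in> parcs \<Gamma> then nat l else nat m)"
      if uv: "u \<in> pverts \<Gamma>" "v \<in> pverts \<Gamma>" "u \<noteq> v" for u v
    proof -
      obtain i where i: "u = f (i mod int n)" using uv(1) by (rule vert_cases)
      obtain j where j: "v = f (j mod int n)" using uv(2) by (rule vert_cases)
      have "\<not> int n dvd i - j" using f_mod_eq_iff[of i j] i j uv(3) by simp
      then have "r (i - j) = (if s (i - j) then l else m)" by (rule lm)
      then have "int (card (common_neighbours \<Gamma> u v)) = (if (u, v) \<in> parcs \<Gamma> then l else m)"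
        using card_common_neighbours[of i j] adj_mod[of i j] i j by simp
      then show ?thesis by (metis nat_int)
    qed
    have ne: "u \<noteq> v" if uv: "(u, v) \<in> parcs \<Gamma>" "u \<in> pverts \<Gamma>" for u v
    proof
      assume "u = v"
      moreover obtain i where "u = f (i mod int n)" using uv(2) by (rule vert_cases)
      ultimately show False using uv adj_mod[of i i] s0 by simp
    qed
    have "strongly_regular \<Gamma> n k (nat l) (nat m)"
      unfolding strongly_regular_def using reg card ne by simp
    then show False using not_srg by blast
  qed
  show "0 < r g" if g: "\<not> int n dvd g" "\<not> s g" for g
  proof -
    have "common_neighbours \<Gamma> (f (g mod int n)) (f (0 mod int n)) \<noteq> {}"
      by (rule diameter_2_imp_common_neighbour[OF graph diam vert vert])
        (use f_mod_eq_iff[of g 0] adj_mod[of g 0] g in simp_all)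
    moreover have "finite (common_neighbours \<Gamma> (f (g mod int n)) (f (0 mod int n)))"
      using bij_betw_finite[OF bij] by (simp add: common_neighbours_def)
    ultimately have "card (common_neighbours \<Gamma> (f (g mod int n)) (f (0 mod int n))) > 0"
      by (simp add: card_gt_0_iff)
    then show ?thesis using card_common_neighbours[of g 0] by simp
  qed
qed

end

section \<open>Circulants on \<open>2p\<close> vertices\<close>

text \<open>The case \<open>p = 2\<close>, outside the reach of the parity arguments. Diameter 2
  forces \<open>s 1\<close>, which leaves the complete graph and the 4-cycle, both strongly
  regular.\<close>

lemma not_strictly_deza_4:
  assumes "circulant_param \<Gamma> 4 f s"
  shows "\<not> strictly_deza \<Gamma> 4 k b a"
proof
  assume deza: "strictly_deza \<Gamma> 4 k b a"
  interpret circulant_param \<Gamma> 4 f s by fact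
  have mod4: "s i = s j" if "[i = j] (mod 4)" for i j
    using periodic_mod_cong[of s "int 4" i j, OF per] that by simp
  have s: "s 3 = s 1" "s (- 1) = s 1" "s (- 2) = s 2"
    using mod4[of 3 "- 1"] mod4[of "- 2" 2] sym[of 1] by (simp_all add: cong_def)
  have sum: "(\<Sum>i\<in>{0..<4}. F i) = F 0 + F 1 + F 2 + F 3" for F :: "int \<Rightarrow> int"
  proof -
    have "{0..<4} = {0, 1, 2, 3 :: int}" by auto
    then show ?thesis by simp
  qed
  have r_sum: "r g = of_bool (s 0 \<and> s g) + of_bool (s 1 \<and> s (g - 1)) + of_bool (s 2 \<and> s (g - 2)) +
      of_bool (s 3 \<and> s (g - 3))" for g
    unfolding r_def conv_def of_nat_numeral sum by (simp add: of_bool_conj)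
  have r: "r 1 = 2 * of_bool (s 1 \<and> s 2)" "r 2 = 2 * of_bool (s 1)" "r 3 = 2 * of_bool (s 1 \<and> s 2)"
    using s0 by (auto simp: r_sum s)
  have s1: "s 1"
    using strictly_deza_r(5)[OF deza, of 1] r by (cases "s 1") auto
  have "r g = (if s g then 2 * of_bool (s 2) else 2)" if g: "\<not> int 4 dvd g" for g
  proof -
    have "r (g mod 4) = r g"
      using conv_periodic[of "\<lambda>i. of_bool (s i)" "int 4" _ g] per by (simp add: r_def)
    moreover have "s (g mod 4) = s g" using per[of g] by simp
    moreover have "g mod 4 \<in> {1, 2, 3}" using g by (auto simp: dvd_eq_mod_eq_0)
    ultimately show ?thesis using r s s1 by auto
  qed
  then show False using strictly_deza_r(4)[OF deza] by blast
qed

section \<open>Reduction from Z/2p to Z/p\<close>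

locale circulant_2p = circulant_param \<Gamma> "2 * p" f s
  for \<Gamma> :: "'v pair_pre_digraph" and p f s +
  fixes k b a :: nat
  assumes prime_p: "prime p" "odd p"
    and deza: "strictly_deza \<Gamma> (2 * p) k b a"
begin

text \<open>\<open>(p + 1) i\<close> and \<open>(p + 1) i + p\<close> are the even and the odd lift of \<open>i\<close> from \<open>\<int>/p\<close> to \<open>\<int>/2p\<close>.\<close>
definition s\<^sub>0 :: "int \<Rightarrow> bool" where "s\<^sub>0 i = s ((int p + 1) * i)"

definition s\<^sub>1 :: "int \<Rightarrow> bool" where "s\<^sub>1 i = s ((int p + 1) * i + int p)"

lemma s_cong: "2 * int p dvd i - j \<Longrightarrow> s i = s j"
  using periodic_mod_cong[of s "int (2 * p)" i j, OF per] by (simp add: cong_iff_dvd_diff)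

lemma even_Suc_p: "even (int p + 1)"
  using prime_p by simp

lemma dvd_Suc_p_mult: "2 * int p dvd (int p + 1) * (int p * j)"
  using even_Suc_p by (auto elim!: evenE)

sublocale symmetric_pair p s\<^sub>0 s\<^sub>1
proof
  have *: "2 * int p dvd (int p + 1) * (i mod int p) - (int p + 1) * i" for i
  proof -
    have "i mod int p - i = int p * (- (i div int p))"
      by (simp add: minus_mult_div_eq_mod [symmetric] algebra_simps)
    then show ?thesis using dvd_Suc_p_mult by (metis right_diff_distrib)
  qed
  show "s\<^sub>0 (i mod int p) = s\<^sub>0 i" for i
    unfolding s\<^sub>0_def by (rule s_cong) (rule *)
  show "s\<^sub>1 (i mod int p) = s\<^sub>1 i" for i
    unfolding s\<^sub>1_def by (rule s_cong) (use *[of i] in simp)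
  show "s\<^sub>0 (- i) = s\<^sub>0 i" for i
    using sym[of "(int p + 1) * i"] by (simp add: s\<^sub>0_def)
  show "s\<^sub>1 (- i) = s\<^sub>1 i" for i
  proof -
    have "s\<^sub>1 (- i) = s (- ((int p + 1) * i + int p))"
      unfolding s\<^sub>1_def by (rule s_cong) simp
    then show ?thesis by (simp only: sym s\<^sub>1_def)
  qed
  show "\<not> s\<^sub>0 0" using s0 by (simp add: s\<^sub>0_def)
qed (rule prime_p)+

lemma s_minus_p: "s ((int p + 1) * i - int p) = s\<^sub>1 i"
  unfolding s\<^sub>1_def by (rule s_cong) simp

lemma sum_split:
  fixes F :: "int \<Rightarrow> int"
  assumes "\<And>i. F (i mod (2 * int p)) = F i"
  shows "(\<Sum>i\<in>{0..<2 * int p}. F i) =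
    (\<Sum>i\<in>{0..<int p}. F ((int p + 1) * i) + F ((int p + 1) * i + int p))"
  using sum_crt_two[of "int p" F] assms prime_p prime_gt_0_nat by simp

lemma r_split:
  "r x = (\<Sum>i\<in>{0..<int p}. of_bool (s ((int p + 1) * i)) * of_bool (s (x - (int p + 1) * i)) +
     of_bool (s ((int p + 1) * i + int p)) * of_bool (s (x - ((int p + 1) * i + int p))))"
proof -
  have "s (x - i mod (2 * int p)) = s (x - i)" for i
    by (rule s_cong) (simp add: minus_mod_eq_mult_div)
  moreover have "s (i mod (2 * int p)) = s i" for i using per[of i] by simp
  ultimately show ?thesis
    using sum_split[of "\<lambda>i. of_bool (s i) * of_bool (s (x - i))"] by (simp add: r_def conv_def)
qed

text \<open>The component without z in the square of A + zB, where z^2 = 1;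
  \<open>r_odd_part\<close> is the other component.\<close>

lemma r_even_part: "r ((int p + 1) * g) = r\<^sub>0 g"
proof -
  have "s ((int p + 1) * g - (int p + 1) * i) = s\<^sub>0 (g - i)"
    "s ((int p + 1) * g - ((int p + 1) * i + int p)) = s\<^sub>1 (g - i)" for i
    using s_minus_p[of "g - i"] by (simp_all add: s\<^sub>0_def algebra_simps)
  then show ?thesis
    by (simp add: r_split r\<^sub>0_def conv_def A_def B_def sum.distrib s\<^sub>0_def s\<^sub>1_def)
qed

lemma r_odd_part: "r ((int p + 1) * g + int p) = r\<^sub>1 g"
proof -
  have "s ((int p + 1) * g + int p - (int p + 1) * i) = s\<^sub>1 (g - i)"
    "s ((int p + 1) * g + int p - ((int p + 1) * i + int p)) = s\<^sub>0 (g - i)" for i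
    by (simp_all add: s\<^sub>0_def s\<^sub>1_def algebra_simps)
  then have "r ((int p + 1) * g + int p) = conv (int p) A B g + conv (int p) B A g"
    by (simp add: r_split conv_def A_def B_def sum.distrib s\<^sub>0_def s\<^sub>1_def)
  also have "conv (int p) B A g = conv (int p) A B g"
    by (rule conv_commute) (use prime_p prime_gt_0_nat in \<open>simp_all add: A_def B_def per_a per_b\<close>)
  finally show ?thesis by (simp add: r\<^sub>1_def)
qed

lemma dvd_even_part_iff: "2 * int p dvd (int p + 1) * g \<longleftrightarrow> int p dvd g"
proof
  assume "2 * int p dvd (int p + 1) * g"
  then have "int p dvd int p * g + g" by (metis dvd_mult_right distrib_right mult_1)
  then show "int p dvd g" by (simp add: dvd_add_right_iff)
next
  assume "int p dvd g"
  then show "2 * int p dvd (int p + 1) * g" using dvd_Suc_p_mult by auto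
qed

lemma not_dvd_odd_part: "\<not> 2 * int p dvd (int p + 1) * g + int p"
proof
  assume "2 * int p dvd (int p + 1) * g + int p"
  then have "even ((int p + 1) * g + int p)" by (rule dvd_mult_left)
  then show False using prime_p by simp
qed

text \<open>\<open>p * x\<close> is congruent to 0 or to \<open>p\<close> modulo
  \<open>2 * p\<close> according to the parity of \<open>x\<close>, so each \<open>x\<close> is its
  own even or odd lift.\<close>

lemma residue_cases:
  obtains (even) "2 * int p dvd x - (int p + 1) * x"
  | (odd) "2 * int p dvd x - ((int p + 1) * x + int p)"
proof (cases "even x")
  case True
  have "x - (int p + 1) * x = int p * (- x)" by (simp add: algebra_simps)
  then show thesis using True even by (metis dvd_minus_iff dvd_triv_right mult.commute mult_dvd_mono dvd_refl)
next
  case False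
  have "x - ((int p + 1) * x + int p) = (- (x + 1)) * int p" by (simp add: algebra_simps)
  moreover have "even (- (x + 1))" using False by simp
  ultimately show thesis using odd by (metis mult_dvd_mono dvd_refl)
qed

lemma r_cong: "2 * int p dvd x - y \<Longrightarrow> r x = r y"
  using periodic_mod_cong[of r "int (2 * p)" x y] conv_periodic[of "\<lambda>i. of_bool (s i)" "int (2 * p)"] per
  by (simp add: r_def cong_iff_dvd_diff)

lemma dvd_cong: "2 * int p dvd x - y \<Longrightarrow> 2 * int p dvd x \<longleftrightarrow> 2 * int p dvd y"
  by (metis dvd_diff_commute dvd_diff_right_iff)

text \<open>The nonzero residues modulo \<open>2 * p\<close> are the even lifts of nonzero residues
  modulo \<open>p\<close> and the odd lifts of all of them.\<close>

sublocale deza_pair p s\<^sub>0 s\<^sub>1 "int a" "int b"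
proof
  note r_facts = strictly_deza_r[OF deza, simplified of_nat_mult of_nat_numeral]
  have "r\<^sub>0 ` {g. \<not> int p dvd g} \<union> range r\<^sub>1 = r ` {g. \<not> 2 * int p dvd g}" (is "?L = ?R")
  proof (intro equalityI subsetI)
    fix y assume "y \<in> ?L"
    then consider g where "\<not> int p dvd g" "y = r\<^sub>0 g" | g where "y = r\<^sub>1 g" by blast
    then show "y \<in> ?R"
    proof cases
      case (1 g)
      then show ?thesis using dvd_even_part_iff[of g] r_even_part[of g] by (intro image_eqI) auto
    next
      case (2 g)
      then show ?thesis using not_dvd_odd_part[of g] r_odd_part[of g] by (intro image_eqI) auto
    qed
  next
    fix y assume "y \<in> ?R"
    then obtain x where x: "\<not> 2 * int p dvd x" "y = r x" by blast
    show "y \<in> ?L"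
    proof (cases rule: residue_cases[of x])
      case even
      then have "y = r\<^sub>0 x" "\<not> int p dvd x"
        using x r_cong[OF even] r_even_part[of x] dvd_cong[OF even] dvd_even_part_iff[of x] by simp_all
      then show ?thesis by blast
    next
      case odd
      then have "y = r\<^sub>1 x" using x r_cong[OF odd] r_odd_part[of x] by simp
      then show ?thesis by blast
    qed
  qed
  then show "r\<^sub>0 ` {g. \<not> int p dvd g} \<union> range r\<^sub>1 = {int a, int b}" using r_facts(1) by simp
  show "int a \<le> int b" using r_facts(2) by simp
  show "0 < r\<^sub>1 g" if "\<not> s\<^sub>1 g" for g
    using r_facts(5)[OF not_dvd_odd_part] that by (simp add: s\<^sub>1_def r_odd_part)
  show "\<nexists>l m. (\<forall>g. \<not> int p dvd g \<longrightarrow> r\<^sub>0 g = (if s\<^sub>0 g then l else m)) \<and>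
      (\<forall>g. r\<^sub>1 g = (if s\<^sub>1 g then l else m))"
  proof
    assume "\<exists>l m. (\<forall>g. \<not> int p dvd g \<longrightarrow> r\<^sub>0 g = (if s\<^sub>0 g then l else m)) \<and>
      (\<forall>g. r\<^sub>1 g = (if s\<^sub>1 g then l else m))"
    then obtain l m where r0: "\<And>g. \<not> int p dvd g \<Longrightarrow> r\<^sub>0 g = (if s\<^sub>0 g then l else m)"
      and r1: "\<And>g. r\<^sub>1 g = (if s\<^sub>1 g then l else m)" by blast
    have "r x = (if s x then l else m)" if x: "\<not> 2 * int p dvd x" for x
    proof (cases rule: residue_cases[of x])
      case even
      then show ?thesis
        using r0[of x] x r_cong[OF even] r_even_part[of x] dvd_cong[OF even] dvd_even_part_iff[of x]
          s_cong[OF even] by (simp add: s\<^sub>0_def)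
    next
      case odd
      then show ?thesis
        using r1[of x] r_cong[OF odd] r_odd_part[of x] s_cong[OF odd] by (simp add: s\<^sub>1_def)
    qed
    then show False using r_facts(4) by blast
  qed
qed

lemma k_eq: "int k = 2 * \<kappa> + 1"
proof -
  have "int k = (\<Sum>i\<in>{0..<2 * int p}. of_bool (s i))"
    using strictly_deza_r(3)[OF deza] by simp
  also have "\<dots> = (\<Sum>i\<in>{0..<int p}. A i) + (\<Sum>i\<in>{0..<int p}. B i)"
    using sum_split[of "\<lambda>i. of_bool (s i)"] per by (simp add: A_def B_def sum.distrib s\<^sub>0_def s\<^sub>1_def)
  finally show ?thesis by (simp add: \<kappa>_def[symmetric] sum_B)
qed

end

section \<open>Identification with the Paley graph\<close>

lemma paley_graph_residue_ring:
  assumes "prime p" "i \<in> {0..<int p}" "j \<in> {0..<int p}"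
  shows "(i, j) \<in> parcs (paley_graph (residue_ring (int p))) \<longleftrightarrow>
    \<not> int p dvd i - j \<and> (\<exists>y. [i - j = y * y] (mod int p))"
proof -
  let ?R = "residue_ring (int p)"
  interpret residues_prime p ?R by unfold_locales (use assms in simp_all)
  have pos: "int p > 1" using assms(1) prime_gt_1_nat by simp
  have carrier: "i \<in> carrier ?R" "j \<in> carrier ?R" using assms by (simp_all add: res_carrier_eq)
  have diff: "i \<oplus>\<^bsub>?R\<^esub> inv\<^bsub>add_monoid ?R\<^esub> j = (i - j) mod int p"
    using res_neg_eq[of j] by (simp add: a_inv_def res_add_eq mod_simps)
  have "(i - j) mod int p \<in> (\<lambda>x. x \<otimes>\<^bsub>?R\<^esub> x) ` Units ?R \<longleftrightarrow>
      (\<exists>x\<in>{1..int p - 1}. (i - j) mod int p = x * x mod int p)"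
    unfolding res_prime_units_eq res_mult_eq of_nat_diff[OF prime_ge_1_nat[OF assms(1)]] of_nat_1
    by (rule image_iff)
  also have "\<dots> \<longleftrightarrow> \<not> int p dvd i - j \<and> (\<exists>y. [i - j = y * y] (mod int p))"
  proof
    assume "\<exists>x\<in>{1..int p - 1}. (i - j) mod int p = x * x mod int p"
    then obtain x where x: "x \<in> {1..int p - 1}" "[i - j = x * x] (mod int p)" by (auto simp: cong_def)
    then have "\<not> int p dvd x" using zdvd_not_zless[of x "int p"] by auto
    then have "\<not> int p dvd x * x" using assms(1) by (simp add: prime_dvd_mult_iff)
    then show "\<not> int p dvd i - j \<and> (\<exists>y. [i - j = y * y] (mod int p))"
      using cong_dvd_iff[OF x(2)] x(2) by blast
  next
    assume "\<not> int p dvd i - j \<and> (\<exists>y. [i - j = y * y] (mod int p))"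
    then obtain y where y: "\<not> int p dvd i - j" "[i - j = y * y] (mod int p)" by blast
    then have "\<not> int p dvd y" using cong_dvd_iff[OF y(2)] by auto
    then have "y mod int p \<noteq> 0" by (simp add: dvd_eq_mod_eq_0)
    moreover have "0 \<le> y mod int p" "y mod int p < int p" using pos by simp_all
    ultimately have "y mod int p \<in> {1..int p - 1}" by auto
    moreover have "(i - j) mod int p = (y mod int p) * (y mod int p) mod int p"
      using y(2) by (simp add: cong_def mod_simps)
    ultimately show "\<exists>x\<in>{1..int p - 1}. (i - j) mod int p = x * x mod int p" by blast
  qed
  finally show ?thesis
    using carrier diff by (simp add: paley_graph_def cayley_graph_def)
qed

context circulant_2p
begin

text \<open>The twist by \<open>t\<close> in \<open>e\<close> carries the squares to
  \<open>s\<^sub>0\<close>, and the second coordinate chooses the coset of the even residues. By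
  \<open>b_iff\<close>, the odd differences add only the edges inside the cliques of size 2.\<close>

lemma iso_paley_extension:
  assumes t: "\<not> int p dvd t"
    and paley: "\<And>h. \<not> int p dvd h \<Longrightarrow> s\<^sub>0 (t * h) \<longleftrightarrow> (\<exists>y. [h = y * y] (mod int p))"
  shows "digraph_iso (with_proj \<Gamma>)
    (with_proj (two_clique_extension (paley_graph (residue_ring (int p)))))"
proof -
  let ?P = "paley_graph (residue_ring (int p))"
  let ?T = "two_clique_extension ?P"
  interpret \<Gamma>: pair_graph \<Gamma> by (rule graph)
  define e where "e = (\<lambda>(i, d::nat). ((int p + 1) * (t * i) + int p * int d) mod (2 * int p))"
  have pP: "pverts ?P = {0..<int p}"
    by (auto simp: paley_graph_def cayley_graph_def residue_ring_def)
  have pT: "pverts ?T = {0..<int p} \<times> {0, 1}"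
    by (simp add: two_clique_extension_def lexicographic_product_def complete_graph_def pP)
  have "coprime t (int p)" using t prime_p by (metis coprime_commute prime_imp_coprime prime_int)
  then have "bij_betw e ({0..<int p} \<times> {0, 1}) {0..<2 * int p}"
    unfolding e_def by (intro bij_betw_crt_two) (use pos prime_p in simp_all)
  then have bij_fe: "bij_betw (f \<circ> e) (pverts ?T) (pverts \<Gamma>)"
    unfolding pT using bij by (intro bij_betw_trans[of e _ "{0..<2 * int p}"]) simp_all
  have wfT: "pair_wf_digraph ?T"
    by unfold_locales (auto simp: two_clique_extension_def lexicographic_product_def)
  have s0_t: "s\<^sub>0 (t * h) \<longleftrightarrow> \<not> int p dvd h \<and> (\<exists>y. [h = y * y] (mod int p))" for h
    using paley not_a_dvd[of "t * h"] by (cases "int p dvd h") auto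
  have adj_iff: "(u, v) \<in> parcs ?T \<longleftrightarrow> ((f \<circ> e) u, (f \<circ> e) v) \<in> parcs \<Gamma>"
    if uv: "u \<in> pverts ?T" "v \<in> pverts ?T" for u v
  proof -
    obtain i d j d' where u: "u = (i, d)" and v: "v = (j, d')" by fastforce
    have ij: "i \<in> {0..<int p}" "j \<in> {0..<int p}" and d: "d \<in> {0, 1}" "d' \<in> {0, 1}"
      using uv unfolding pT u v by auto
    have i_j: "i = j \<longleftrightarrow> int p dvd i - j"
      using ij by (auto simp: mod_eq_dvd_iff [symmetric])
    have "((f \<circ> e) u, (f \<circ> e) v) \<in> parcs \<Gamma> \<longleftrightarrow>
        s ((int p + 1) * (t * i) + int p * int d - ((int p + 1) * (t * j) + int p * int d'))"
      using adj_mod[of "(int p + 1) * (t * i) + int p * int d" "(int p + 1) * (t * j) + int p * int d'"]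
      by (simp add: u v e_def)
    also have "\<dots> \<longleftrightarrow> (if d = d' then s\<^sub>0 (t * (i - j)) else s\<^sub>1 (t * (i - j)))"
      using d s_minus_p[of "t * (i - j)"] by (auto simp: s\<^sub>0_def s\<^sub>1_def algebra_simps)
    also have "\<dots> \<longleftrightarrow> s\<^sub>0 (t * (i - j)) \<or> i = j \<and> d \<noteq> d'"
    proof -
      have "int p dvd t * (i - j) \<longleftrightarrow> int p dvd i - j"
        using t prime_int by (simp add: prime_dvd_mult_iff)
      then show ?thesis using b_iff[of "t * (i - j)"] i_j not_a_dvd[of "t * (i - j)"] by auto
    qed
    also have "\<dots> \<longleftrightarrow> (u, v) \<in> parcs ?T"
      using paley_graph_residue_ring[OF prime_p(1) ij] s0_t[of "i - j"] ij d
      by (simp add: u v two_clique_extension_def lexicographic_product_def complete_graph_def pP)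
    finally show ?thesis ..
  qed
  have "digraph_iso (with_proj ?T) (with_proj \<Gamma>)"
    unfolding digraph_iso_with_proj_iff[OF wfT \<Gamma>.pair_wf_digraph_axioms]
    using bij_fe adj_iff by blast
  then show ?thesis
    by (rule digraph_iso_swap[rotated]) (simp add: wf_digraph_wp_iff wfT)
qed

end

theorem theorem15:
  fixes p k b a :: nat and \<Gamma> :: "'v pair_pre_digraph"
  assumes "prime p"
    and "circulant TYPE('g) \<Gamma>"
    and "strictly_deza \<Gamma> (2 * p) k b a"
  shows "[p = 1] (mod 4) \<and>
    digraph_iso (with_proj \<Gamma>)
      (with_proj (two_clique_extension (paley_graph (residue_ring (int p))))) \<and>
    k = p \<and> b = p - 1 \<and> a = (p - 1) div 2"
proof -
  have "pair_graph \<Gamma>" "card (pverts \<Gamma>) = 2 * p"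
    using assms(3) by (auto simp: strictly_deza_def deza_graph_def regular_graph_def)
  then obtain f s where param: "circulant_param \<Gamma> (2 * p) f s"
    using circulant_imp_param[OF assms(2)] assms(1) prime_gt_0_nat by (metis mult_pos_pos pos2)
  have "p \<noteq> 2"
    using not_strictly_deza_4[of \<Gamma> f s k b a] param assms(3) by auto
  then have "odd p" using assms(1) primes_dvd_imp_eq two_is_prime_nat by blast
  then interpret circulant_2p \<Gamma> p f s k b a
    using param assms by (intro circulant_2p.intro circulant_2p_axioms.intro)
  obtain c t where c: "int p = 4 * c + 1" "int a = 2 * c" "int b = 4 * c" "\<kappa> = 2 * c"
    and t: "\<not> int p dvd t" "\<And>h. \<not> int p dvd h \<Longrightarrow> s\<^sub>0 (t * h) \<longleftrightarrow> (\<exists>y. [h = y * y] (mod int p))"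
    using paley_structure by blast
  have "k = p" "b = p - 1" "a = (p - 1) div 2" using c k_eq by linarith+
  moreover have "[int p = 1] (mod 4)" using c(1) by (simp add: cong_iff_dvd_diff)
  then have "[p = 1] (mod 4)" using cong_int_iff[of p 1 4] by simp
  ultimately show ?thesis using iso_paley_extension[OF t] by blast
qed

end
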